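(* Let $H$ be a separable complex Hilbert space, $A$ a strictly positive selfadjoint operator on $H$ with spectral measure $E_A$, and $f:\sigma(A)\to[0,\infty)$ a continuous function. Let $S(t)=e^{t\mathbb{A}}$ be the contraction semigroup on $\mathcal{H}=H^1\times H$ generated by the operator $\mathbb{A}(u,v)=(v,-Au-f(A)v)$ defined in the context, and let $\mathfrak{Z}=\{s\in\sigma(A): f(s)=0\}$. Then: (i) If $E_A(\mathfrak{Z})\neq 0$ (i.e. it is not the null projection), then there exist solutions with constant positive energy, that is, there is $z_0\in\mathcal{H}$ such that $\mathcal{E}(t)=\frac12\|S(t)z_0\|_{\mathcal{H}}^2$ is a positive constant for $t\ge 0$. In particular, the semigroup $S(t)$ is not stable. (ii) If $E_A(\mathfrak{Z})=0$ and the set $\mathfrak{Z}$ is at most countable, then the semigroup $S(t)$ is stable. In particular, this is always the case if $\mathfrak{Z}=\emptyset$.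
   Context: $(H,\langle\cdot,\cdot\rangle,\|\cdot\|)$ is a separable complex Hilbert space and $A:\mathrm{dom}(A)\subset H\to H$ is a strictly positive selfadjoint linear operator (so $\sigma(A)$ is a nonempty closed subset of $(0,\infty)$; $A$ may be bounded or unbounded and $A^{-1}$ is not necessarily compact). $f:\sigma(A)\to[0,\infty)$ is continuous, and $f(A)=\int_{\sigma(A)}f(s)\,dE_A(s)$ is the selfadjoint operator given by the functional calculus, $E_A$ being the (projection-valued) spectral measure of $A$ on $\sigma(A)$. For $r>0$, $H^r=\mathrm{dom}(A^{r/2})$ with norm $\|u\|_r=\|A^{r/2}u\|$. The phase space is $\mathcal{H}=H^1\times H$ with norm $\|(u,v)\|_{\mathcal{H}}^2=\|u\|_1^2+\|v\|^2$. The operator $\mathbb{A}$ is $\mathbb{A}(u,v)=(v,\,-(Au+f(A)v))$ with domain $\mathrm{dom}(\mathbb{A})=\{(u,v)\in\mathcal{H}: v\in H^1,\ Au+f(A)v\in H\}$. Here, when $u\notin\mathrm{dom}(A)$ or $v\notin\mathrm{dom}(f(A))$, $Au$ and $f(A)v$ are understood by duality, as the functionals $w\mapsto\langle Aw,u\rangle$ on $\mathrm{dom}(A)$ and $w\mapsto\langle f(A)w,v\rangle$ on $\mathrm{dom}(f(A))$; thus $Au+f(A)v\in H$ means that there is $h\in H$ (then denoted $Au+f(A)v$) with $\langle Aw,u\rangle+\langle f(A)w,v\rangle=\langle w,h\rangle$ for all $w\in\mathrm{dom}(A)\cap\mathrm{dom}(f(A))$. The operator $\mathbb{A}$ generates a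 strongly continuous contraction semigroup $S(t)=e^{t\mathbb{A}}$ on $\mathcal{H}$; for $z_0\in\mathcal{H}$ the (mild) solution with initial datum $z_0$ is $S(t)z_0$ and its energy is $\mathcal{E}(t)=\frac12\|S(t)z_0\|_{\mathcal{H}}^2$. $S(t)$ is called stable if $\lim_{t\to\infty}\|S(t)z_0\|_{\mathcal{H}}=0$ for every fixed $z_0\in\mathcal{H}$. *)

theory Defs
  imports "HOL-Analysis.Analysis"
begin

section \<open>Complex Hilbert spaces\<close>

class complex_vector = real_vector +
  fixes scaleC :: "complex \<Rightarrow> 'a \<Rightarrow> 'a"  (infixr "*\<^sub>C" 75)
  assumes scaleC_add_right: "a *\<^sub>C (x + y) = a *\<^sub>C x + a *\<^sub>C y"
    and scaleC_add_left: "(a + b) *\<^sub>C x = a *\<^sub>C x + b *\<^sub>C x"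
    and scaleC_scaleC: "a *\<^sub>C (b *\<^sub>C x) = (a * b) *\<^sub>C x"
    and scaleC_of_real: "complex_of_real r *\<^sub>C x = r *\<^sub>R x"

text \<open>The inner product is linear in its first argument and conjugate linear in the second.\<close>

class complex_inner = complex_vector + real_normed_vector +
  fixes cinner :: "'a \<Rightarrow> 'a \<Rightarrow> complex"
  assumes cinner_commute: "cinner x y = cnj (cinner y x)"
    and cinner_add_left: "cinner (x + y) z = cinner x z + cinner y z"
    and cinner_scaleC_left: "cinner (a *\<^sub>C x) y = a * cinner x y"
    and cinner_self: "cinner x x = complex_of_real ((norm x)\<^sup>2)"

class complex_hilbert = complex_inner + complete_space

instantiation prod :: (complex_vector, complex_vector) complex_vector
begin

definition scaleC_prod :: "complex \<Rightarrow> 'a \<times> 'b \<Rightarrow> 'a \<times> 'b" where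
  "scaleC_prod a z = (a *\<^sub>C fst z, a *\<^sub>C snd z)"

instance
  by standard
    (auto simp: scaleC_prod_def prod_eq_iff scaleC_add_right scaleC_add_left
      scaleC_scaleC scaleC_of_real)

end


section \<open>Unbounded operators\<close>

text \<open>
  A (possibly unbounded) operator is represented by its graph: \<open>(x, y) \<in> A\<close> means that \<open>x\<close> is in
  the domain of \<open>A\<close> and \<open>A x = y\<close>. Its domain is \<open>Domain A\<close>, and equality of operators includes
  equality of domains.
\<close>

definition linear_operator :: "('a::complex_vector \<times> 'a) set \<Rightarrow> bool" where
  "linear_operator A \<longleftrightarrow>
     single_valued A \<and> (0, 0) \<in> A \<and>
     (\<forall>p\<in>A. \<forall>q\<in>A. p + q \<in> A) \<and> (\<forall>a. \<forall>p\<in>A. a *\<^sub>C p \<in> A)"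

definition op_app :: "('a \<times> 'a) set \<Rightarrow> 'a \<Rightarrow> 'a" where
  "op_app A x = (THE y. (x, y) \<in> A)"

definition adjoint_graph :: "('a::complex_inner \<times> 'a) set \<Rightarrow> ('a \<times> 'a) set" where
  "adjoint_graph A = {(y, z). \<forall>(x, w)\<in>A. cinner w y = cinner x z}"

definition selfadjoint :: "('a::complex_inner \<times> 'a) set \<Rightarrow> bool" where
  "selfadjoint A \<longleftrightarrow>
     linear_operator A \<and> closure (Domain A) = UNIV \<and> adjoint_graph A = A"

definition strictly_positive :: "('a::complex_inner \<times> 'a) set \<Rightarrow> bool" where
  "strictly_positive A \<longleftrightarrow>
     (\<exists>c>0. \<forall>(x, y)\<in>A. c * (norm x)\<^sup>2 \<le> Re (cinner y x))"

text \<open>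
  As \<open>A\<close> is single-valued, bijectivity of \<open>(x, y) \<mapsto> y - \<lambda>x\<close> on the graph is bijectivity of
  \<open>A - \<lambda>\<close> from the domain of \<open>A\<close> onto the space.
\<close>

definition resolvent_set :: "('a::complex_inner \<times> 'a) set \<Rightarrow> complex set" where
  "resolvent_set A =
     {l. bij_betw (\<lambda>(x, y). y - l *\<^sub>C x) A UNIV \<and>
         (\<exists>C. \<forall>(x, y)\<in>A. norm x \<le> C * norm (y - l *\<^sub>C x))}"

definition spectrum :: "('a::complex_inner \<times> 'a) set \<Rightarrow> complex set" where
  "spectrum A = - resolvent_set A"

text \<open>For selfadjoint \<open>A\<close> the spectrum is real, so the following is all of it.\<close>

definition real_spectrum :: "('a::complex_inner \<times> 'a) set \<Rightarrow> real set" where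
  "real_spectrum A = {s. complex_of_real s \<in> spectrum A}"


section \<open>Spectral measures and functional calculus\<close>

definition orthogonal_projection :: "('a::complex_inner \<Rightarrow> 'a) \<Rightarrow> bool" where
  "orthogonal_projection P \<longleftrightarrow>
     (\<forall>x y. P (x + y) = P x + P y) \<and> (\<forall>a x. P (a *\<^sub>C x) = a *\<^sub>C P x) \<and>
     (\<forall>x. P (P x) = P x) \<and> (\<forall>x y. cinner (P x) y = cinner x (P y))"

text \<open>Of the measure space \<open>M\<close> only the underlying sigma-algebra is used.\<close>

definition projection_valued_measure ::
    "'s measure \<Rightarrow> ('s set \<Rightarrow> 'a::complex_inner \<Rightarrow> 'a) \<Rightarrow> bool" where
  "projection_valued_measure M E \<longleftrightarrow>
     (\<forall>B\<in>sets M. orthogonal_projection (E B)) \<and>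
     (\<forall>x. E (space M) x = x) \<and>
     (\<forall>F :: nat \<Rightarrow> 's set. range F \<subseteq> sets M \<longrightarrow> disjoint_family F \<longrightarrow>
        (\<forall>x. (\<lambda>n. E (F n) x) sums E (\<Union>n. F n) x))"

text \<open>The scalar measure \<open>B \<mapsto> \<langle>E(B)x, x\<rangle> = \<parallel>E(B)x\<parallel>\<^sup>2\<close>.\<close>

definition scalar_measure ::
    "'s measure \<Rightarrow> ('s set \<Rightarrow> 'a::complex_inner \<Rightarrow> 'a) \<Rightarrow> 'a \<Rightarrow> 's measure" where
  "scalar_measure M E x =
     measure_of (space M) (sets M) (\<lambda>B. ennreal (Re (cinner (E B x) x)))"

text \<open>
  The operator \<open>\<integral> g dE\<close> for a real function \<open>g\<close>. Its domain consists of the \<open>x\<close> with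
  \<open>\<integral> |g|\<^sup>2 d\<langle>E x, x\<rangle> < \<infinity>\<close>; its value at such an \<open>x\<close> is the norm limit of
  \<open>(\<integral> s\<^sub>n dE) x = (\<Sum>c. c E(s\<^sub>n = c) x)\<close> for simple functions \<open>s\<^sub>n\<close> converging to \<open>g\<close> in
  \<open>L\<^sup>2(\<langle>E x, x\<rangle>)\<close>, and does not depend on the choice of the \<open>s\<^sub>n\<close>, by the isometry
  \<open>\<parallel>(\<integral> s dE) x\<parallel>\<^sup>2 = \<integral> |s|\<^sup>2 d\<langle>E x, x\<rangle>\<close>.
\<close>

definition spectral_integral ::
    "'s measure \<Rightarrow> ('s set \<Rightarrow> 'a::complex_inner \<Rightarrow> 'a) \<Rightarrow> ('s \<Rightarrow> real) \<Rightarrow> ('a \<times> 'a) set" where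
  "spectral_integral M E g =
     {(x, y).
        (\<integral>\<^sup>+ t. ennreal ((g t)\<^sup>2) \<partial>scalar_measure M E x) < \<infinity> \<and>
        (\<exists>s :: nat \<Rightarrow> 's \<Rightarrow> real.
           (\<forall>n. simple_function M (s n)) \<and>
           (\<lambda>n. \<integral>\<^sup>+ t. ennreal ((s n t - g t)\<^sup>2) \<partial>scalar_measure M E x) \<longlonglongrightarrow> 0 \<and>
           (\<lambda>n. \<Sum>c\<in>s n ` space M. c *\<^sub>R E (s n -` {c} \<inter> space M) x) \<longlonglongrightarrow> y)}"

abbreviation spectrum_borel :: "('a::complex_inner \<times> 'a) set \<Rightarrow> real measure" where
  "spectrum_borel A \<equiv> restrict_space borel (real_spectrum A)"

text \<open>\<open>E\<close> is the spectral measure of \<open>A\<close>, that is \<open>A = \<integral> s dE(s)\<close> over the spectrum of \<open>A\<close>.\<close>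

definition is_spectral_measure ::
    "('a::complex_inner \<times> 'a) set \<Rightarrow> (real set \<Rightarrow> 'a \<Rightarrow> 'a) \<Rightarrow> bool" where
  "is_spectral_measure A E \<longleftrightarrow>
     projection_valued_measure (spectrum_borel A) E \<and>
     spectral_integral (spectrum_borel A) E (\<lambda>s. s) = A"

text \<open>
  The operator \<open>g(A)\<close>. In this and the following definitions \<open>E\<close> is meant to be the spectral
  measure of \<open>A\<close>.
\<close>

definition fun_calc ::
    "('a::complex_inner \<times> 'a) set \<Rightarrow> (real set \<Rightarrow> 'a \<Rightarrow> 'a) \<Rightarrow> (real \<Rightarrow> real) \<Rightarrow> ('a \<times> 'a) set" where
  "fun_calc A E g = spectral_integral (spectrum_borel A) E g"


section \<open>Contraction semigroups\<close>

text \<open>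
  A normed space is given here by a subspace \<open>X\<close> of an ambient complex vector space together with
  a norm \<open>N\<close> on \<open>X\<close>, which need not be the restriction of a norm of the ambient space.
\<close>

definition contraction_semigroup ::
    "'b::complex_vector set \<Rightarrow> ('b \<Rightarrow> real) \<Rightarrow> (real \<Rightarrow> 'b \<Rightarrow> 'b) \<Rightarrow> bool" where
  "contraction_semigroup X N S \<longleftrightarrow>
     (\<forall>t\<ge>0. \<forall>z\<in>X. S t z \<in> X) \<and>
     (\<forall>t\<ge>0. \<forall>z\<in>X. \<forall>w\<in>X. S t (z + w) = S t z + S t w) \<and>
     (\<forall>t\<ge>0. \<forall>a. \<forall>z\<in>X. S t (a *\<^sub>C z) = a *\<^sub>C S t z) \<and>
     (\<forall>z\<in>X. S 0 z = z) \<and>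
     (\<forall>s\<ge>0. \<forall>t\<ge>0. \<forall>z\<in>X. S (s + t) z = S s (S t z)) \<and>
     (\<forall>z\<in>X. ((\<lambda>t. N (S t z - z)) \<longlongrightarrow> 0) (at_right 0)) \<and>
     (\<forall>t\<ge>0. \<forall>z\<in>X. N (S t z) \<le> N z)"

definition generator ::
    "'b::complex_vector set \<Rightarrow> ('b \<Rightarrow> real) \<Rightarrow> (real \<Rightarrow> 'b \<Rightarrow> 'b) \<Rightarrow> ('b \<times> 'b) set" where
  "generator X N S =
     {(z, w). z \<in> X \<and> w \<in> X \<and>
        ((\<lambda>t. N ((1 / t) *\<^sub>R (S t z - z) - w)) \<longlongrightarrow> 0) (at_right 0)}"

definition stable_semigroup :: "'b set \<Rightarrow> ('b \<Rightarrow> real) \<Rightarrow> (real \<Rightarrow> 'b \<Rightarrow> 'b) \<Rightarrow> bool" where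
  "stable_semigroup X N S \<longleftrightarrow> (\<forall>z\<in>X. ((\<lambda>t. N (S t z)) \<longlongrightarrow> 0) at_top)"


section \<open>The damped abstract wave equation\<close>

definition sobolev_space ::
    "('a::complex_inner \<times> 'a) set \<Rightarrow> (real set \<Rightarrow> 'a \<Rightarrow> 'a) \<Rightarrow> real \<Rightarrow> 'a set" where
  "sobolev_space A E r = Domain (fun_calc A E (\<lambda>s. s powr (r / 2)))"

definition sobolev_norm ::
    "('a::complex_inner \<times> 'a) set \<Rightarrow> (real set \<Rightarrow> 'a \<Rightarrow> 'a) \<Rightarrow> real \<Rightarrow> 'a \<Rightarrow> real" where
  "sobolev_norm A E r u = norm (op_app (fun_calc A E (\<lambda>s. s powr (r / 2))) u)"

definition phase_space ::
    "('a::complex_inner \<times> 'a) set \<Rightarrow> (real set \<Rightarrow> 'a \<Rightarrow> 'a) \<Rightarrow> ('a \<times> 'a) set" where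
  "phase_space A E = sobolev_space A E 1 \<times> UNIV"

definition phase_norm ::
    "('a::complex_inner \<times> 'a) set \<Rightarrow> (real set \<Rightarrow> 'a \<Rightarrow> 'a) \<Rightarrow> 'a \<times> 'a \<Rightarrow> real" where
  "phase_norm A E z = sqrt ((sobolev_norm A E 1 (fst z))\<^sup>2 + (norm (snd z))\<^sup>2)"

text \<open>
  The operator \<open>(u, v) \<mapsto> (v, -(Au + f(A)v))\<close>, where \<open>h = Au + f(A)v\<close> is understood by duality
  with the vectors \<open>w\<close> in the domains of both \<open>A\<close> (with \<open>Aw = a\<close>) and \<open>f(A)\<close> (with \<open>f(A)w = b\<close>).
\<close>

definition wave_operator ::
    "('a::complex_inner \<times> 'a) set \<Rightarrow> (real set \<Rightarrow> 'a \<Rightarrow> 'a) \<Rightarrow> (real \<Rightarrow> real) \<Rightarrow>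
     (('a \<times> 'a) \<times> ('a \<times> 'a)) set" where
  "wave_operator A E f =
     {((u, v), (v, - h)) | u v h.
        (u, v) \<in> phase_space A E \<and> v \<in> sobolev_space A E 1 \<and>
        (\<forall>w a b. (w, a) \<in> A \<longrightarrow> (w, b) \<in> fun_calc A E f \<longrightarrow>
           cinner a u + cinner b v = cinner w h)}"

definition energy ::
    "('a::complex_inner \<times> 'a) set \<Rightarrow> (real set \<Rightarrow> 'a \<Rightarrow> 'a) \<Rightarrow>
     (real \<Rightarrow> 'a \<times> 'a \<Rightarrow> 'a \<times> 'a) \<Rightarrow> 'a \<times> 'a \<Rightarrow> real \<Rightarrow> real" where
  "energy A E S z t = (1 / 2) * (phase_norm A E (S t z))\<^sup>2"

end

(*
  In the spectral representation the equation decouples into damped oscillators u'' + f(s) u' + s u = 0,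
  and this is exploited through the spectral projections alone: E(B) acting on both components
  commutes with the generator, so the range of E(B) is invariant under the semigroup. If A is bounded
  and f vanishes on B, the energy of solutions in this range has zero derivative. If A and f(A) are
  bounded on it and f is bounded below by some d > 0 on B, perturbing the energy by a small multiple
  of Re <u, v> gives a Lyapunov function, so these solutions decay. When E(Z) = 0, the sets
  B_n = {|s| <= n, 1/(n+1) <= f(s) <= n} exhaust the spectrum up to a null set, and stability follows
  by density and contractivity.
*)

theory Submission
  imports Defs
begin

subsection \<open>Complex inner products\<close>

text \<open>Commuting with the generator does not by definition mean commuting with S(t); that
  passage is the main obstacle. It is overcome by a norm argument: if \<open>Q\<close> commutes with
  the generator, the norm of \<open>Q (S t z)\<close> does not increase along orbits that start in
  the domain of the generator. For the projection over the complement of B this shows that a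
  component starting at 0 stays 0. The generator is a limit from the right, so orbits come with
  right derivatives only, and monotonicity is deduced from continuity together with one-sided slope
  bounds. Boundedness of A and f on B puts the whole range of E(B) into the domain of the generator,
  so that energies can be differentiated at every time; the bound on f also enters the decay
  constant. Norms and quadratic forms are computed as integrals against the finite measures sending
  B to the squared norm of E(B)x, where bounds on s and f(s) can be used pointwise. Positivity of
  the spectrum enters in the same almost-everywhere sense.\<close>

lemma cinner_add_right: "cinner x (y + z) = cinner x y + cinner x z"
  by (metis cinner_add_left cinner_commute complex_cnj_add)

lemma cinner_scaleC_right: "cinner x (a *\<^sub>C y) = cnj a * cinner x y"
  by (metis cinner_commute cinner_scaleC_left complex_cnj_mult)

lemma cinner_scaleR_left: "cinner (r *\<^sub>R x) y = r *\<^sub>R cinner x y"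
  by (metis cinner_scaleC_left scaleC_of_real scaleR_conv_of_real)

lemma cinner_scaleR_right: "cinner x (r *\<^sub>R y) = r *\<^sub>R cinner x y"
  by (metis cinner_scaleC_right complex_cnj_complex_of_real scaleC_of_real scaleR_conv_of_real)

lemma Re_cinner_self: "Re (cinner x x) = (norm x)\<^sup>2"
  by (simp add: cinner_self)

lemma Re_cinner_commute: "Re (cinner x y) = Re (cinner y x)"
  by (subst cinner_commute) simp

lemma norm_add_square: "(norm (x + y))\<^sup>2 = (norm x)\<^sup>2 + 2 * Re (cinner x y) + (norm y)\<^sup>2"
  for x y :: "'a::complex_inner"
  by (simp add: Re_cinner_self[symmetric] cinner_add_left cinner_add_right Re_cinner_commute[of y x])

lemma norm_scaleC: "norm (a *\<^sub>C x) = cmod a * norm x"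
  for x :: "'a::complex_inner"
proof -
  have "complex_of_real ((norm (a *\<^sub>C x))\<^sup>2) = of_real ((cmod a * norm x)\<^sup>2)"
    unfolding cinner_self[symmetric] cinner_scaleC_left cinner_scaleC_right
    by (simp add: cinner_self power_mult_distrib complex_norm_square del: of_real_power)
  then show ?thesis
    unfolding of_real_eq_iff by (simp add: power2_eq_iff_nonneg)
qed

text \<open>The triangle inequality is part of the class, so Cauchy-Schwarz is read off from it by
  expanding a square, reversing the usual order.\<close>

lemma Re_cinner_le: "Re (cinner x y) \<le> norm x * norm y"
  for x y :: "'a::complex_inner"
proof -
  have "(norm (x + y))\<^sup>2 \<le> (norm x + norm y)\<^sup>2"
    by (simp add: norm_triangle_ineq)
  then show ?thesis
    by (simp add: norm_add_square power2_sum)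
qed

lemma norm_cinner_le: "cmod (cinner x y) \<le> norm x * norm y"
  for x y :: "'a::complex_inner"
proof -
  \<comment> \<open>The phase that makes the inner product real and nonnegative. If the inner
    product is 0, then so is \<open>a\<close>; hence only the modulus bound by 1 is used
    below.\<close>
  define a where "a = cnj (sgn (cinner x y))"
  have "a * cinner x y = of_real (cmod (cinner x y))"
    by (simp add: a_def sgn_eq complex_norm_square[symmetric] mult.commute power2_eq_square)
  then have "cmod (cinner x y) = Re (cinner (a *\<^sub>C x) y)"
    by (simp add: cinner_scaleC_left)
  also have "\<dots> \<le> norm (a *\<^sub>C x) * norm y"
    by (rule Re_cinner_le)
  also have "\<dots> \<le> norm x * norm y"
    by (intro mult_right_mono) (auto simp: norm_scaleC a_def norm_sgn)
  finally show ?thesis .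
qed

lemma bounded_bilinear_cinner: "bounded_bilinear (cinner :: 'a::complex_inner \<Rightarrow> _)"
proof
  show "\<exists>K. \<forall>a b. norm (cinner a b) \<le> norm a * norm b * K" for a b :: 'a
    by (rule exI[of _ 1]) (simp add: norm_cinner_le)
qed (simp_all add: cinner_add_left cinner_add_right cinner_scaleR_left cinner_scaleR_right)

lemma bounded_bilinear_Re_cinner: "bounded_bilinear (\<lambda>x y::'a::complex_inner. Re (cinner x y))"
proof
  show "\<exists>K. \<forall>a b::'a. norm (Re (cinner a b)) \<le> norm a * norm b * K"
    by (intro exI[of _ 1] allI) (simp add: order_trans[OF abs_Re_le_cmod norm_cinner_le])
qed (simp_all add: cinner_add_left cinner_add_right cinner_scaleR_left cinner_scaleR_right)

lemmas tendsto_cinner = bounded_bilinear.tendsto[OF bounded_bilinear_cinner]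
lemmas cinner_diff_left = bounded_bilinear.diff_left[OF bounded_bilinear_cinner]
lemmas cinner_diff_right = bounded_bilinear.diff_right[OF bounded_bilinear_cinner]
lemmas cinner_minus_left = bounded_bilinear.minus_left[OF bounded_bilinear_cinner]
lemmas cinner_minus_right = bounded_bilinear.minus_right[OF bounded_bilinear_cinner]
lemmas cinner_sum_left = bounded_bilinear.sum_left[OF bounded_bilinear_cinner]
lemmas cinner_sum_right = bounded_bilinear.sum_right[OF bounded_bilinear_cinner]
lemmas cinner_zero_left = bounded_bilinear.zero_left[OF bounded_bilinear_cinner]
lemmas cinner_zero_right = bounded_bilinear.zero_right[OF bounded_bilinear_cinner]

lemma norm_diff_square: "(norm (x - y))\<^sup>2 = (norm x)\<^sup>2 - 2 * Re (cinner x y) + (norm y)\<^sup>2"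
  for x y :: "'a::complex_inner"
  using norm_add_square[of x "- y"] by (simp add: cinner_minus_right)

subsection \<open>Spectral integrals\<close>

locale pvm =
  fixes M :: "'s measure" and E :: "'s set \<Rightarrow> 'a::complex_hilbert \<Rightarrow> 'a"
  assumes pvm: "projection_valued_measure M E"
begin

section \<open>Algebra of the spectral projections\<close>

lemma
  assumes "B \<in> sets M"
  shows E_add: "E B (x + y) = E B x + E B y"
    and E_scaleC: "E B (a *\<^sub>C x) = a *\<^sub>C E B x"
    and E_idem: "E B (E B x) = E B x"
    and E_sym: "cinner (E B x) y = cinner x (E B y)"
proof -
  have "orthogonal_projection (E B)"
    using pvm assms by (simp add: projection_valued_measure_def)
  then show "E B (x + y) = E B x + E B y" "E B (a *\<^sub>C x) = a *\<^sub>C E B x"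
    "E B (E B x) = E B x" "cinner (E B x) y = cinner x (E B y)"
    by (simp_all add: orthogonal_projection_def)
qed

lemma E_space: "E (space M) x = x"
  using pvm by (simp add: projection_valued_measure_def)

lemma E_sums:
  "range F \<subseteq> sets M \<Longrightarrow> disjoint_family F \<Longrightarrow> (\<lambda>n. E (F n) x) sums E (\<Union>n. F n) x"
  for F :: "nat \<Rightarrow> 's set"
  using pvm by (simp add: projection_valued_measure_def)

lemma Re_cinner_E: "B \<in> sets M \<Longrightarrow> Re (cinner (E B x) x) = (norm (E B x))\<^sup>2"
  by (simp add: Re_cinner_self[symmetric] E_sym E_idem)

lemma norm_E_le:
  assumes B: "B \<in> sets M"
  shows "norm (E B x) \<le> norm x"
proof -
  have "norm (E B x) * norm (E B x) \<le> norm (E B x) * norm x"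
    using Re_cinner_le[of "E B x" x] Re_cinner_E[OF B] by (simp add: power2_eq_square)
  then show ?thesis
    by (cases "norm (E B x) = 0") simp_all
qed

lemma bounded_linear_E:
  assumes "B \<in> sets M"
  shows "bounded_linear (E B)"
proof (rule bounded_linear_intro[of _ 1])
  show "E B (r *\<^sub>R x) = r *\<^sub>R E B x" for r x
    using E_scaleC[OF assms, of "complex_of_real r" x] by (simp add: scaleC_of_real)
qed (use assms in \<open>simp_all add: E_add norm_E_le\<close>)

lemmas E_diff = linear_diff[OF bounded_linear.linear[OF bounded_linear_E]]
lemmas E_minus = linear_neg[OF bounded_linear.linear[OF bounded_linear_E]]
lemmas E_zero = linear_0[OF bounded_linear.linear[OF bounded_linear_E]]
lemmas E_scaleR = linear_cmul[OF bounded_linear.linear[OF bounded_linear_E]]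
lemmas E_sum = linear_sum[OF bounded_linear.linear[OF bounded_linear_E]]

text \<open>The constant family of empty sets is disjoint, so countable additivity gives a
  convergent series with constant terms, which must vanish.\<close>

lemma E_empty: "E {} x = 0"
proof -
  have "(\<lambda>n::nat. E {} x) sums E {} x"
    using E_sums[of "\<lambda>_. {}"] by (simp add: disjoint_family_on_def)
  then have "(\<lambda>n::nat. E {} x) \<longlonglongrightarrow> 0"
    by (rule sums_summable[THEN summable_LIMSEQ_zero])
  then show ?thesis
    by (simp add: LIMSEQ_const_iff)
qed

lemma E_Un:
  assumes "B \<in> sets M" "C \<in> sets M" "B \<inter> C = {}"
  shows "E (B \<union> C) x = E B x + E C x"
proof -
  have "range (binaryset B C) \<subseteq> sets M"
    using assms by (simp add: range_binaryset_eq)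
  moreover have "disjoint_family (binaryset B C)"
    using assms by (auto simp: disjoint_family_on_def binaryset_def)
  ultimately have "(\<lambda>n. E (binaryset B C n) x) sums E (B \<union> C) x"
    using E_sums[of "binaryset B C" x] by (simp add: UN_binaryset_eq)
  moreover have "(\<lambda>n. E (binaryset B C n) x) sums (E B x + E C x)"
    by (rule binaryset_sums[of "\<lambda>B. E B x"]) (rule E_empty)
  ultimately show ?thesis
    by (rule sums_unique2)
qed

text \<open>The sum of the two projections is again a projection, which forces \<open>PQ + QP = 0\<close>.\<close>

lemma E_disjoint:
  assumes B: "B \<in> sets M" and C: "C \<in> sets M" and "B \<inter> C = {}"
  shows "E B (E C x) = 0"
proof -
  note Un = E_Un[OF assms]
  have U: "B \<union> C \<in> sets M" using B C by simp
  have anti: "E B (E C y) + E C (E B y) = 0" for y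
    using E_idem[OF U, of y]
    by (simp add: Un E_add[OF B] E_add[OF C] E_idem[OF B] E_idem[OF C])
  have 1: "E B (E C x) + E B (E C (E B x)) = 0"
    using arg_cong[OF anti[of x], of "E B"]
    by (simp add: E_add[OF B] E_idem[OF B] E_zero[OF B])
  have 2: "E B (E C (E B x)) + E C (E B x) = 0"
    using anti[of "E B x"] by (simp add: E_idem[OF B])
  have "E B (E C x) = E C (E B x)"
    using 1 2 by (metis add.commute add_left_cancel)
  with anti[of x] have "2 *\<^sub>R E B (E C x) = 0"
    by (simp add: scaleR_2)
  then show ?thesis by simp
qed

text \<open>After splitting both sets along their intersection, the mixed products belong to
  disjoint sets and vanish.\<close>

lemma E_Int:
  assumes B: "B \<in> sets M" and C: "C \<in> sets M"
  shows "E B (E C x) = E (B \<inter> C) x"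
proof -
  have s: "B \<inter> C \<in> sets M" "B - C \<in> sets M" "C - B \<in> sets M" using B C by auto
  have "B \<inter> C \<union> (B - C) = B" "B \<inter> C \<union> (C - B) = C" by blast+
  then have "E B y = E (B \<inter> C) y + E (B - C) y" and "E C x = E (B \<inter> C) x + E (C - B) x" for y
    using E_Un[OF s(1) s(2), of y] E_Un[OF s(1) s(3), of x] by auto
  moreover have "E (B \<inter> C) (E (C - B) x) = 0" "E (B - C) (E (B \<inter> C) x) = 0"
      "E (B - C) (E (C - B) x) = 0"
    by (rule E_disjoint; use s in blast)+
  ultimately show ?thesis
    by (simp add: E_add[OF s(1)] E_add[OF s(2)] E_idem[OF s(1)])
qed

lemma E_commute: "B \<in> sets M \<Longrightarrow> C \<in> sets M \<Longrightarrow> E B (E C x) = E C (E B x)"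
  by (simp add: E_Int Int_commute)

lemma E_Compl:
  assumes "B \<in> sets M"
  shows "E (space M - B) x = x - E B x"
proof -
  have "B \<union> (space M - B) = space M"
    using sets.sets_into_space[OF assms] by blast
  then have "x = E B x + E (space M - B) x"
    using E_Un[OF assms sets.compl_sets[OF assms], of x] E_space[of x] by simp
  then show ?thesis by (metis add_diff_cancel_left')
qed

section \<open>Scalar measures of vectors\<close>

abbreviation \<mu> :: "'a \<Rightarrow> 's measure" where
  "\<mu> x \<equiv> scalar_measure M E x"

lemma sets_\<mu> [measurable_cong]: "sets (\<mu> x) = sets M"
  unfolding scalar_measure_def by (simp add: sets.sigma_sets_eq sets.space_closed)

lemma space_\<mu>: "space (\<mu> x) = space M"
  by (rule sets_eq_imp_space_eq[OF sets_\<mu>])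

text \<open>\<open>measure_of\<close> returns the given set function only once it is known to be a
  measure. Countable additivity comes from strong convergence of the projections, paired with
  \<open>x\<close>.\<close>

lemma emeasure_\<mu>:
  assumes "B \<in> sets M"
  shows "emeasure (\<mu> x) B = ennreal ((norm (E B x))\<^sup>2)"
proof -
  have "emeasure (\<mu> x) B = ennreal (Re (cinner (E B x) x))"
    unfolding scalar_measure_def
  proof (rule emeasure_measure_of_sigma[OF sets.sigma_algebra_axioms _ _ assms])
    show "positive (sets M) (\<lambda>B. ennreal (Re (cinner (E B x) x)))"
      unfolding positive_def E_empty cinner_zero_left by simp
    show "countably_additive (sets M) (\<lambda>B. ennreal (Re (cinner (E B x) x)))"
    proof (rule countably_additiveI)
      fix F :: "nat \<Rightarrow> 's set"
      assume F: "range F \<subseteq> sets M" "disjoint_family F"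
      have "(\<lambda>n. Re (cinner (E (F n) x) x)) sums Re (cinner (E (\<Union>n. F n) x) x)"
        by (rule bounded_linear.sums[OF bounded_bilinear.bounded_linear_left[OF bounded_bilinear_Re_cinner] E_sums[OF F]])
      moreover have "0 \<le> Re (cinner (E (F n) x) x)" for n
      proof -
        have "F n \<in> sets M" using F by blast
        then show ?thesis by (simp only: Re_cinner_E zero_le_power2)
      qed
      ultimately show "(\<Sum>n. ennreal (Re (cinner (E (F n) x) x))) = ennreal (Re (cinner (E (\<Union>n. F n) x) x))"
        by (intro suminf_ennreal_eq)
    qed
  qed
  then show ?thesis
    by (simp only: Re_cinner_E[OF assms])
qed

lemma finite_measure_\<mu>: "finite_measure (\<mu> x)"
  by (rule finite_measureI) (simp add: emeasure_\<mu> space_\<mu>)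

lemma measure_\<mu>: "B \<in> sets M \<Longrightarrow> measure (\<mu> x) B = (norm (E B x))\<^sup>2"
  by (simp add: measure_def emeasure_\<mu>)

lemma AE_\<mu>_iff:
  assumes "{t \<in> space M. \<not> P t} \<in> sets M"
  shows "(AE t in \<mu> x. P t) \<longleftrightarrow> E {t \<in> space M. \<not> P t} x = 0"
  using assms by (subst AE_iff_measurable[OF _ refl]) (auto simp: sets_\<mu> space_\<mu> emeasure_\<mu>)

text \<open>The bridge from pointwise bounds on \<open>B\<close> to estimates for vectors in the
  range of \<open>E B\<close>.\<close>

lemma AE_\<mu>_range:
  assumes B: "B \<in> sets M" and x: "E B x = x"
  shows "AE t in \<mu> x. t \<in> B"
proof -
  have *: "{t \<in> space M. t \<notin> B} = space M - B" by auto
  show ?thesis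
    using B by (subst AE_\<mu>_iff) (simp_all add: * E_Compl x)
qed

section \<open>Integrals of simple functions and their isometry\<close>

definition simple_op :: "('s \<Rightarrow> real) \<Rightarrow> 'a \<Rightarrow> 'a" where
  "simple_op s x = (\<Sum>c\<in>s ` space M. c *\<^sub>R E (s -` {c} \<inter> space M) x)"

lemma simple_function_\<mu>: "simple_function (\<mu> x) s \<longleftrightarrow> simple_function M s"
  by (rule simple_function_cong_algebra) (simp_all add: sets_\<mu> space_\<mu>)

lemma integrable_simple:
  assumes "simple_function M s"
  shows "integrable (\<mu> x) s"
proof -
  interpret finite_measure "\<mu> x" by (rule finite_measure_\<mu>)
  have "simple_function (\<mu> x) s" using assms by (simp add: simple_function_\<mu>)
  then show ?thesis by (rule integrable_simple_function) simp
qed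

lemma simple_level_sets:
  assumes "simple_function M s"
  shows "s -` {c} \<inter> space M \<in> sets M"
  using assms by (rule simple_functionD)

lemma simple_eq_sum:
  fixes s :: "'s \<Rightarrow> real"
  assumes "simple_function M s" "t \<in> space M"
  shows "s t = (\<Sum>c\<in>s ` space M. c * indicator (s -` {c} \<inter> space M) t)"
proof -
  have "(\<Sum>c\<in>s ` space M. c * indicator (s -` {c} \<inter> space M) t) =
      (\<Sum>c\<in>s ` space M. if c = s t then s t else 0)"
    using assms(2) by (intro sum.cong) auto
  also have "\<dots> = s t"
    using assms(2) simple_functionD(1)[OF assms(1)] by (simp add: sum.delta)
  finally show ?thesis ..
qed

text \<open>Both sides are a double sum over the values of \<open>s\<close> and \<open>r\<close>:
  two level-set projections multiply to the projection of the intersection, whose quadratic form at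
  \<open>x\<close> is the scalar measure. Two functions are allowed so that differences can be
  treated as well.\<close>

lemma Re_cinner_simple_op:
  assumes s: "simple_function M s" and r: "simple_function M r"
  shows "Re (cinner (simple_op s x) (simple_op r x)) = (\<integral>t. s t * r t \<partial>\<mu> x)"
proof -
  interpret finite_measure "\<mu> x" by (rule finite_measure_\<mu>)
  define B where "B c = s -` {c} \<inter> space M" for c
  define C where "C d = r -` {d} \<inter> space M" for d
  have BC [simp]: "B c \<in> sets M" "C d \<in> sets M" for c d
    unfolding B_def C_def using s r by (simp_all add: simple_level_sets)
  have E: "Re (cinner (E (B c) x) (E (C d) x)) = measure (\<mu> x) (B c \<inter> C d)" for c d
    using Re_cinner_E[OF sets.Int[OF BC], of c d x]
    unfolding measure_\<mu>[OF sets.Int[OF BC]] E_sym[OF BC(1)] E_Int[OF BC]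
    by (simp only: Re_cinner_commute[of x])
  have "(\<integral>t. s t * r t \<partial>\<mu> x) =
     (\<integral>t. (\<Sum>c\<in>s ` space M. \<Sum>d\<in>r ` space M. c * d * indicator (B c \<inter> C d) t) \<partial>\<mu> x)"
  proof (rule Bochner_Integration.integral_cong[OF refl])
    fix t assume "t \<in> space (\<mu> x)"
    then have t: "t \<in> space M" by (simp add: space_\<mu>)
    show "s t * r t = (\<Sum>c\<in>s ` space M. \<Sum>d\<in>r ` space M. c * d * indicator (B c \<inter> C d) t)"
      unfolding simple_eq_sum[OF s t] simple_eq_sum[OF r t] sum_product B_def C_def indicator_inter_arith
      by (simp add: mult_ac)
  qed
  also have "\<dots> = (\<Sum>c\<in>s ` space M. \<Sum>d\<in>r ` space M. c * d * measure (\<mu> x) (B c \<inter> C d))"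
  proof -
    have "integrable (\<mu> x) (indicator (B c \<inter> C d) :: 's \<Rightarrow> real)" for c d
      by (rule integrable_real_indicator) (simp_all add: sets_\<mu> emeasure_\<mu> sets.Int)
    moreover have "(\<integral>t. indicator (B c \<inter> C d) t \<partial>\<mu> x) = measure (\<mu> x) (B c \<inter> C d)" for c d
      using sets.Int_space_eq2[OF sets.Int[OF BC], of c d] by (simp only: space_\<mu> Bochner_Integration.integral_indicator)
    ultimately show ?thesis by simp
  qed
  also have "\<dots> = Re (cinner (simple_op s x) (simple_op r x))"
    unfolding simple_op_def B_def[symmetric] C_def[symmetric]
    by (subst sum.swap) (simp add: cinner_sum_left cinner_sum_right cinner_scaleR_left
        cinner_scaleR_right E[symmetric] sum_distrib_left mult.assoc mult.left_commute)
  finally show ?thesis ..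
qed

text \<open>Expanding the square through the mixed formula avoids comparing the level sets of
  \<open>s\<close>, \<open>r\<close> and their difference.\<close>

lemma norm_simple_op_diff:
  assumes s: "simple_function M s" and r: "simple_function M r"
  shows "ennreal ((norm (simple_op s x - simple_op r x))\<^sup>2) = (\<integral>\<^sup>+t. ennreal ((s t - r t)\<^sup>2) \<partial>\<mu> x)"
proof -
  have i: "integrable (\<mu> x) (\<lambda>t. s t * s t)" "integrable (\<mu> x) (\<lambda>t. s t * r t)" "integrable (\<mu> x) (\<lambda>t. r t * r t)"
    using s r by (auto intro!: integrable_simple simple_function_mult)
  have e: "(s t - r t)\<^sup>2 = s t * s t - 2 * (s t * r t) + r t * r t" for t
    by (simp add: power2_eq_square algebra_simps)
  have "(norm (simple_op s x - simple_op r x))\<^sup>2 = (\<integral>t. (s t - r t)\<^sup>2 \<partial>\<mu> x)"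
    unfolding norm_diff_square e unfolding Re_cinner_self[symmetric] Re_cinner_simple_op[OF s s] Re_cinner_simple_op[OF r r] Re_cinner_simple_op[OF s r]
    using i by simp
  moreover have "integrable (\<mu> x) (\<lambda>t. (s t - r t)\<^sup>2)"
    unfolding e using i by simp
  ultimately show ?thesis
    by (simp add: nn_integral_eq_integral)
qed

lemma norm_simple_op:
  assumes "simple_function M s"
  shows "(norm (simple_op s x))\<^sup>2 = (\<integral>t. (s t)\<^sup>2 \<partial>\<mu> x)"
  using Re_cinner_simple_op[OF assms assms, of x] by (simp add: Re_cinner_self power2_eq_square)

lemma Re_cinner_simple_op_self:
  assumes s: "simple_function M s"
  shows "Re (cinner (simple_op s x) x) = (\<integral>t. s t \<partial>\<mu> x)"
\<comment> \<open>The idea is to pair with the constant 1, whose operator is the identity. On an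
  empty space that function has no values and its sum is empty, but then \<open>E {}\<close> is the
  identity and every vector is 0.\<close>
proof (cases "space M = {}")
  case True
  then have "x = 0" using E_empty[of x] E_space[of x] by simp
  moreover have "(\<integral>t. s t \<partial>\<mu> x) = (\<integral>t. 0 \<partial>\<mu> x)"
    using True by (intro Bochner_Integration.integral_cong) (simp_all add: space_\<mu>)
  ultimately show ?thesis by (simp add: cinner_zero_right)
next
  case False
  have "(\<lambda>_. 1) ` space M = {1::real}" "(\<lambda>_. 1::real) -` {1} \<inter> space M = space M" using False by auto
  then have "simple_op (\<lambda>_. 1) x = x" by (simp add: simple_op_def E_space)
  then show ?thesis using Re_cinner_simple_op[OF s simple_function_const[of _ 1], of x] by simp
qed

lemma
  assumes s: "simple_function M s"
  shows simple_op_add: "simple_op s (x + y) = simple_op s x + simple_op s y"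
    and simple_op_scaleC: "simple_op s (a *\<^sub>C x) = a *\<^sub>C simple_op s x"
    and simple_op_E: "B \<in> sets M \<Longrightarrow> simple_op s (E B x) = E B (simple_op s x)"
    and simple_op_sym: "cinner (simple_op s x) y = cinner x (simple_op s y)"
proof -
  note m = simple_level_sets[OF s]
  show "simple_op s (x + y) = simple_op s x + simple_op s y"
    by (simp add: simple_op_def E_add[OF m] scaleR_add_right sum.distrib)
  have "a *\<^sub>C (\<Sum>i\<in>I. h i) = (\<Sum>i\<in>I. a *\<^sub>C h i)" for h :: "real \<Rightarrow> 'a" and I
    by (rule additive.sum) (simp add: additive.intro scaleC_add_right)
  moreover have "a *\<^sub>C (c *\<^sub>R z) = c *\<^sub>R (a *\<^sub>C z)" for c and z :: 'a
    by (simp add: scaleC_of_real[symmetric] scaleC_scaleC mult.commute)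
  ultimately show "simple_op s (a *\<^sub>C x) = a *\<^sub>C simple_op s x"
    by (simp add: simple_op_def E_scaleC[OF m])
  show "simple_op s (E B x) = E B (simple_op s x)" if "B \<in> sets M"
    using that by (simp add: simple_op_def E_sum E_scaleR E_commute[OF m])
  show "cinner (simple_op s x) y = cinner x (simple_op s y)"
    by (simp add: simple_op_def cinner_sum_left cinner_sum_right cinner_scaleR_left cinner_scaleR_right E_sym[OF m])
qed

section \<open>Spectral integrals of unbounded functions\<close>

abbreviation SI :: "('s \<Rightarrow> real) \<Rightarrow> ('a \<times> 'a) set" where
  "SI g \<equiv> spectral_integral M E g"

lemma dominated_\<mu>:
  assumes s: "\<And>n. simple_function M (s n)"
    and lim: "\<And>t. t \<in> space M \<Longrightarrow> (\<lambda>n. s n t) \<longlonglongrightarrow> g t"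
    and bound: "\<And>n t. t \<in> space M \<Longrightarrow> \<bar>s n t\<bar> \<le> 2 * \<bar>g t\<bar>"
    and g: "g \<in> borel_measurable M"
    and fin: "(\<integral>\<^sup>+t. ennreal ((g t)\<^sup>2) \<partial>\<mu> x) < \<infinity>"
  shows "(\<lambda>n. \<integral>\<^sup>+t. ennreal ((s n t - g t)\<^sup>2) \<partial>\<mu> x) \<longlonglongrightarrow> 0"
proof -
  have sm: "s n \<in> borel_measurable M" for n
    using s by (rule borel_measurable_simple_function)
  \<comment> \<open>The distance from \<open>s n t\<close> to \<open>g t\<close> is at most 2|g| +
    |g|; 9 is the square of 3.\<close>
  have le: "(s n t - g t)\<^sup>2 \<le> 9 * (g t)\<^sup>2" if "t \<in> space M" for n t
  proof -
    have "\<bar>s n t - g t\<bar> \<le> \<bar>3 * g t\<bar>" using bound[OF that, of n] by linarith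
    then have "(s n t - g t)\<^sup>2 \<le> (3 * g t)\<^sup>2" by (rule abs_le_square_iff[THEN iffD1])
    then show ?thesis by (simp add: power_mult_distrib)
  qed
  have "(\<lambda>n. \<integral>\<^sup>+t. ennreal ((s n t - g t)\<^sup>2) \<partial>\<mu> x) \<longlonglongrightarrow> (\<integral>\<^sup>+t. 0 \<partial>\<mu> x)"
  proof (rule nn_integral_dominated_convergence[where w="\<lambda>t. 9 * ennreal ((g t)\<^sup>2)"])
    show "(\<lambda>t. ennreal ((s n t - g t)\<^sup>2)) \<in> borel_measurable (\<mu> x)" for n
      using sm g by measurable
    show "(\<lambda>t. 9 * ennreal ((g t)\<^sup>2)) \<in> borel_measurable (\<mu> x)"
      using g by measurable
    show "(\<integral>\<^sup>+t. 9 * ennreal ((g t)\<^sup>2) \<partial>\<mu> x) < \<infinity>"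
      using fin g by (subst nn_integral_cmult) (auto simp: ennreal_mult_less_top)
    show "AE t in \<mu> x. ennreal ((s n t - g t)\<^sup>2) \<le> 9 * ennreal ((g t)\<^sup>2)" for n
    proof (rule AE_I2)
      fix t assume "t \<in> space (\<mu> x)"
      then have "ennreal ((s n t - g t)\<^sup>2) \<le> ennreal (9 * (g t)\<^sup>2)"
        using le by (intro ennreal_leI) (simp add: space_\<mu>)
      then show "ennreal ((s n t - g t)\<^sup>2) \<le> 9 * ennreal ((g t)\<^sup>2)"
        by (simp add: ennreal_mult)
    qed
    show "AE t in \<mu> x. (\<lambda>n. ennreal ((s n t - g t)\<^sup>2)) \<longlonglongrightarrow> 0"
    proof (rule AE_I2)
      fix t assume "t \<in> space (\<mu> x)"
      then have "(\<lambda>n. ennreal ((s n t - g t)\<^sup>2)) \<longlonglongrightarrow> ennreal ((g t - g t)\<^sup>2)"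
        by (intro tendsto_ennrealI tendsto_intros lim) (simp add: space_\<mu>)
      then show "(\<lambda>n. ennreal ((s n t - g t)\<^sup>2)) \<longlonglongrightarrow> 0" by simp
    qed
  qed simp
  then show ?thesis by simp
qed

text \<open>The inequality (a - b)^2 <= 2 a^2 + 2 b^2, integrated. It compares two approximations of
  the same \<open>g\<close>, both for independence of the chosen sequence and for the Cauchy
  property.\<close>

lemma norm_simple_op_diff_le:
  assumes s: "simple_function M s" and r: "simple_function M r" and g: "g \<in> borel_measurable M"
  shows "ennreal ((norm (simple_op s x - simple_op r x))\<^sup>2) \<le>
    2 * (\<integral>\<^sup>+t. ennreal ((s t - g t)\<^sup>2) \<partial>\<mu> x) + 2 * (\<integral>\<^sup>+t. ennreal ((r t - g t)\<^sup>2) \<partial>\<mu> x)"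
proof -
  have m: "s \<in> borel_measurable M" "r \<in> borel_measurable M"
    using s r by (auto intro: borel_measurable_simple_function)
  have le: "ennreal ((s t - r t)\<^sup>2) \<le> 2 * ennreal ((s t - g t)\<^sup>2) + 2 * ennreal ((r t - g t)\<^sup>2)" for t
  proof -
    have "0 \<le> (s t - g t + (r t - g t))\<^sup>2" by simp
    then have "(s t - r t)\<^sup>2 \<le> 2 * (s t - g t)\<^sup>2 + 2 * (r t - g t)\<^sup>2"
      by (simp add: power2_eq_square algebra_simps)
    then have "ennreal ((s t - r t)\<^sup>2) \<le> ennreal (2 * (s t - g t)\<^sup>2 + 2 * (r t - g t)\<^sup>2)"
      by (rule ennreal_leI)
    then show ?thesis by (simp add: ennreal_mult)
  qed
  have "ennreal ((norm (simple_op s x - simple_op r x))\<^sup>2) \<le>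
      (\<integral>\<^sup>+t. 2 * ennreal ((s t - g t)\<^sup>2) + 2 * ennreal ((r t - g t)\<^sup>2) \<partial>\<mu> x)"
    unfolding norm_simple_op_diff[OF s r] by (intro nn_integral_mono le)
  also have "\<dots> = 2 * (\<integral>\<^sup>+t. ennreal ((s t - g t)\<^sup>2) \<partial>\<mu> x) + 2 * (\<integral>\<^sup>+t. ennreal ((r t - g t)\<^sup>2) \<partial>\<mu> x)"
    using m g by (subst nn_integral_add; (subst nn_integral_cmult)?; (subst nn_integral_cmult)?; simp?)
  finally show ?thesis .
qed

text \<open>By the isometry the bound on vectors is a bound on the L2 norms of the
  \<open>s n\<close>, which Fatou's lemma passes to the limit \<open>g\<close>.\<close>

lemma finite_integral_if_bounded:
  assumes s: "\<And>n. simple_function M (s n)"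
    and lim: "\<And>t. t \<in> space M \<Longrightarrow> (\<lambda>n. s n t) \<longlonglongrightarrow> g t"
    and bound: "\<And>n. norm (simple_op (s n) x) \<le> C"
  shows "(\<integral>\<^sup>+t. ennreal ((g t)\<^sup>2) \<partial>\<mu> x) < \<infinity>"
proof -
  have i: "integrable (\<mu> x) (\<lambda>t. (s n t)\<^sup>2)" for n
    using integrable_simple[OF simple_function_mult[OF s s]] by (simp add: power2_eq_square)
  have sm: "s n \<in> borel_measurable M" for n
    using s by (rule borel_measurable_simple_function)
  have "(\<integral>\<^sup>+t. ennreal ((g t)\<^sup>2) \<partial>\<mu> x) = (\<integral>\<^sup>+t. liminf (\<lambda>n. ennreal ((s n t)\<^sup>2)) \<partial>\<mu> x)"
  proof (rule nn_integral_cong)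
    fix t assume "t \<in> space (\<mu> x)"
    then have "(\<lambda>n. ennreal ((s n t)\<^sup>2)) \<longlonglongrightarrow> ennreal ((g t)\<^sup>2)"
      by (intro tendsto_ennrealI tendsto_intros lim) (simp add: space_\<mu>)
    then show "ennreal ((g t)\<^sup>2) = liminf (\<lambda>n. ennreal ((s n t)\<^sup>2))"
      by (rule lim_imp_Liminf[OF trivial_limit_sequentially, THEN sym])
  qed
  also have "\<dots> \<le> liminf (\<lambda>n. \<integral>\<^sup>+t. ennreal ((s n t)\<^sup>2) \<partial>\<mu> x)"
    using sm by (intro nn_integral_liminf) measurable
  also have "\<dots> \<le> limsup (\<lambda>n. \<integral>\<^sup>+t. ennreal ((s n t)\<^sup>2) \<partial>\<mu> x)"
    by (rule Liminf_le_Limsup) simp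
  also have "\<dots> \<le> ennreal (C\<^sup>2)"
  proof (rule Limsup_bounded, rule always_eventually, rule allI)
    fix n
    have "(\<integral>\<^sup>+t. ennreal ((s n t)\<^sup>2) \<partial>\<mu> x) = ennreal ((norm (simple_op (s n) x))\<^sup>2)"
      unfolding norm_simple_op[OF s] by (rule nn_integral_eq_integral[OF i]) simp
    also have "\<dots> \<le> ennreal (C\<^sup>2)"
      using bound[of n] by (intro ennreal_leI power_mono) simp_all
    finally show "(\<integral>\<^sup>+t. ennreal ((s n t)\<^sup>2) \<partial>\<mu> x) \<le> ennreal (C\<^sup>2)" .
  qed
  finally show ?thesis
    by (rule order.strict_trans1) simp
qed

text \<open>
  One approximating sequence serves all vectors, and by Fatou's lemma convergence of the values along
  it already implies that the vector belongs to the domain.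
\<close>

lemma spectral_integral_approx:
  assumes g: "g \<in> borel_measurable M"
  obtains s where "\<And>n. simple_function M (s n)"
    and "\<And>t. t \<in> space M \<Longrightarrow> (\<lambda>n. s n t) \<longlonglongrightarrow> g t"
    and "\<And>n t. t \<in> space M \<Longrightarrow> \<bar>s n t\<bar> \<le> 2 * \<bar>g t\<bar>"
    and "\<And>x y. (x, y) \<in> SI g \<longleftrightarrow> (\<lambda>n. simple_op (s n) x) \<longlonglongrightarrow> y"
proof -
  \<comment> \<open>The approximants depend on \<open>g\<close> alone; the constant 2 is the one
    this theorem supplies, and it reappears in the domination arguments.\<close>
  from borel_measurable_implies_sequence_metric[OF g, of 0]
  obtain s where s: "\<And>n. simple_function M (s n)"
    and lim: "\<And>t. t \<in> space M \<Longrightarrow> (\<lambda>n. s n t) \<longlonglongrightarrow> g t"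
    and "\<And>n t. t \<in> space M \<Longrightarrow> dist (s n t) 0 \<le> 2 * dist (g t) 0"
    by blast
  then have bound: "\<And>n t. t \<in> space M \<Longrightarrow> \<bar>s n t\<bar> \<le> 2 * \<bar>g t\<bar>"
    by (simp add: dist_norm)
  have "(x, y) \<in> SI g \<longleftrightarrow> (\<lambda>n. simple_op (s n) x) \<longlonglongrightarrow> y" for x y
  proof
    assume "(x, y) \<in> SI g"
    then obtain r where fin: "(\<integral>\<^sup>+t. ennreal ((g t)\<^sup>2) \<partial>\<mu> x) < \<infinity>"
      and r: "\<And>n. simple_function M (r n)"
      and rg: "(\<lambda>n. \<integral>\<^sup>+t. ennreal ((r n t - g t)\<^sup>2) \<partial>\<mu> x) \<longlonglongrightarrow> 0"
      and ry: "(\<lambda>n. simple_op (r n) x) \<longlonglongrightarrow> y"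
      unfolding spectral_integral_def simple_op_def by blast
    note sg = dominated_\<mu>[OF s lim bound g fin]
    \<comment> \<open>Both sequences approximate \<open>g\<close> in L2 of the scalar measure, so
      their values at \<open>x\<close> approach each other and share the limit
      \<open>y\<close>.\<close>
    have "(\<lambda>n. 2 * (\<integral>\<^sup>+t. ennreal ((s n t - g t)\<^sup>2) \<partial>\<mu> x) + 2 * (\<integral>\<^sup>+t. ennreal ((r n t - g t)\<^sup>2) \<partial>\<mu> x))
        \<longlonglongrightarrow> 2 * 0 + 2 * 0" (is "?d \<longlonglongrightarrow> _")
      by (intro tendsto_add ennreal_tendsto_cmult sg rg) simp_all
    then have "?d \<longlonglongrightarrow> 0" by simp
    from tendsto_sandwich[OF _ _ tendsto_const this]
    have "(\<lambda>n. ennreal ((norm (simple_op (s n) x - simple_op (r n) x))\<^sup>2)) \<longlonglongrightarrow> ennreal 0"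
      by (simp add: norm_simple_op_diff_le[OF s r g])
    then have "(\<lambda>n. (norm (simple_op (s n) x - simple_op (r n) x))\<^sup>2) \<longlonglongrightarrow> 0"
      by (rule tendsto_ennrealD) simp_all
    then have "(\<lambda>n. simple_op (s n) x - simple_op (r n) x) \<longlonglongrightarrow> 0"
      by (simp add: tendsto_norm_zero_iff)
    from tendsto_add[OF this ry] show "(\<lambda>n. simple_op (s n) x) \<longlonglongrightarrow> y" by simp
  next
    assume y: "(\<lambda>n. simple_op (s n) x) \<longlonglongrightarrow> y"
    then have "Bseq (\<lambda>n. simple_op (s n) x)"
      by (rule convergent_imp_Bseq[OF convergentI])
    then obtain C where "\<And>n. norm (simple_op (s n) x) \<le> C"
      by (auto simp: Bseq_def)
    from finite_integral_if_bounded[OF s lim this]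
    have fin: "(\<integral>\<^sup>+t. ennreal ((g t)\<^sup>2) \<partial>\<mu> x) < \<infinity>" .
    from fin s y dominated_\<mu>[OF s lim bound g fin] show "(x, y) \<in> SI g"
      unfolding spectral_integral_def simple_op_def by blast
  qed
  with s lim bound show thesis by (rule that)
qed

lemma finite_integral_SI: "(x, y) \<in> SI g \<Longrightarrow> (\<integral>\<^sup>+t. ennreal ((g t)\<^sup>2) \<partial>\<mu> x) < \<infinity>"
  unfolding spectral_integral_def by blast

text \<open>Each algebraic property holds for the operators of simple functions and passes to the
  limit along one common sequence; uniqueness is that of limits.\<close>

lemma
  assumes g: "g \<in> borel_measurable M"
  shows SI_unique: "(x, y) \<in> SI g \<Longrightarrow> (x, y') \<in> SI g \<Longrightarrow> y = y'"
    and SI_zero: "(0, 0) \<in> SI g"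
    and SI_add: "(x, y) \<in> SI g \<Longrightarrow> (x', y') \<in> SI g \<Longrightarrow> (x + x', y + y') \<in> SI g"
    and SI_scaleC: "(x, y) \<in> SI g \<Longrightarrow> (a *\<^sub>C x, a *\<^sub>C y) \<in> SI g"
    and SI_E: "(x, y) \<in> SI g \<Longrightarrow> B \<in> sets M \<Longrightarrow> (E B x, E B y) \<in> SI g"
    and SI_sym: "(x, y) \<in> SI g \<Longrightarrow> (x', y') \<in> SI g \<Longrightarrow> cinner y x' = cinner x y'"
proof -
  obtain s where s: "\<And>n. simple_function M (s n)"
    and SI: "\<And>x y. (x, y) \<in> SI g \<longleftrightarrow> (\<lambda>n. simple_op (s n) x) \<longlonglongrightarrow> y"
    using spectral_integral_approx[OF g] by metis
  show "y = y'" if "(x, y) \<in> SI g" "(x, y') \<in> SI g"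
    using that unfolding SI by (rule LIMSEQ_unique)
  show "(0, 0) \<in> SI g"
    unfolding SI by (simp add: simple_op_def E_zero[OF simple_level_sets[OF s]])
  show "(x + x', y + y') \<in> SI g" if "(x, y) \<in> SI g" "(x', y') \<in> SI g"
    using that unfolding SI simple_op_add[OF s] by (rule tendsto_add)
  have "bounded_linear (\<lambda>x::'a. a *\<^sub>C x)"
    by (rule bounded_linear_intro[of _ "cmod a"])
      (simp_all add: scaleC_add_right norm_scaleC scaleC_scaleC scaleC_of_real[symmetric] mult.commute)
  then show "(a *\<^sub>C x, a *\<^sub>C y) \<in> SI g" if "(x, y) \<in> SI g"
    using that unfolding SI simple_op_scaleC[OF s] by (rule bounded_linear.tendsto)
  show "(E B x, E B y) \<in> SI g" if "(x, y) \<in> SI g" "B \<in> sets M"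
    using that(1) unfolding SI simple_op_E[OF s that(2)]
    by (rule bounded_linear.tendsto[OF bounded_linear_E[OF that(2)]])
  show "cinner y x' = cinner x y'" if "(x, y) \<in> SI g" "(x', y') \<in> SI g"
  proof (rule LIMSEQ_unique)
    show "(\<lambda>n. cinner (simple_op (s n) x) x') \<longlonglongrightarrow> cinner y x'"
      using that(1) unfolding SI by (intro tendsto_cinner tendsto_const)
    show "(\<lambda>n. cinner (simple_op (s n) x) x') \<longlonglongrightarrow> cinner x y'"
      unfolding simple_op_sym[OF s] using that(2) unfolding SI by (intro tendsto_cinner tendsto_const)
  qed
qed

text \<open>The identities for simple functions pass to the limit by dominated convergence, with
  bounds 2|g| and 4 g^2. Integrability of \<open>g\<close> follows from that of its square because
  the measure is finite.\<close>

lemma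
  assumes g: "g \<in> borel_measurable M" and xy: "(x, y) \<in> SI g"
  shows SI_integrable: "integrable (\<mu> x) g"
    and SI_integrable_square: "integrable (\<mu> x) (\<lambda>t. (g t)\<^sup>2)"
    and SI_Re_cinner: "Re (cinner y x) = (\<integral>t. g t \<partial>\<mu> x)"
    and SI_norm: "(norm y)\<^sup>2 = (\<integral>t. (g t)\<^sup>2 \<partial>\<mu> x)"
proof -
  interpret finite_measure "\<mu> x" by (rule finite_measure_\<mu>)
  have [measurable]: "g \<in> borel_measurable (\<mu> x)" using g by measurable
  obtain s where s: "\<And>n. simple_function M (s n)"
    and lim: "\<And>t. t \<in> space M \<Longrightarrow> (\<lambda>n. s n t) \<longlonglongrightarrow> g t"
    and bound: "\<And>n t. t \<in> space M \<Longrightarrow> \<bar>s n t\<bar> \<le> 2 * \<bar>g t\<bar>"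
    and SI: "\<And>x y. (x, y) \<in> SI g \<longleftrightarrow> (\<lambda>n. simple_op (s n) x) \<longlonglongrightarrow> y"
    using spectral_integral_approx[OF g] by metis
  have sy: "(\<lambda>n. simple_op (s n) x) \<longlonglongrightarrow> y" using xy by (simp add: SI)
  have [measurable]: "s n \<in> borel_measurable (\<mu> x)" for n
    using borel_measurable_simple_function[OF s] by measurable
  show sq: "integrable (\<mu> x) (\<lambda>t. (g t)\<^sup>2)"
    using finite_integral_SI[OF xy] by (intro integrableI_nonneg) auto
  show int: "integrable (\<mu> x) g"
    by (rule square_integrable_imp_integrable[OF _ sq]) measurable
  have "(\<lambda>n. \<integral>t. s n t \<partial>\<mu> x) \<longlonglongrightarrow> (\<integral>t. g t \<partial>\<mu> x)"
    by (rule integral_dominated_convergence[where w="\<lambda>t. 2 * \<bar>g t\<bar>"])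
      (use int lim bound in \<open>auto simp: space_\<mu>\<close>)
  moreover have "(\<lambda>n. Re (cinner (simple_op (s n) x) x)) \<longlonglongrightarrow> Re (cinner y x)"
    by (intro tendsto_Re tendsto_cinner sy tendsto_const)
  ultimately show "Re (cinner y x) = (\<integral>t. g t \<partial>\<mu> x)"
    unfolding Re_cinner_simple_op_self[OF s] by (rule LIMSEQ_unique[rotated])
  have "(\<lambda>n. \<integral>t. (s n t)\<^sup>2 \<partial>\<mu> x) \<longlonglongrightarrow> (\<integral>t. (g t)\<^sup>2 \<partial>\<mu> x)"
  proof (rule integral_dominated_convergence[where w="\<lambda>t. 4 * (g t)\<^sup>2"])
    have "(s n t)\<^sup>2 \<le> 4 * (g t)\<^sup>2" if "t \<in> space M" for n t
    proof -
      have "\<bar>s n t\<bar> \<le> \<bar>2 * g t\<bar>" using bound[OF that, of n] by simp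
      then have "(s n t)\<^sup>2 \<le> (2 * g t)\<^sup>2" by (rule abs_le_square_iff[THEN iffD1])
      then show ?thesis by (simp add: power_mult_distrib)
    qed
    then show "AE t in \<mu> x. norm ((s n t)\<^sup>2) \<le> 4 * (g t)\<^sup>2" for n
      by (intro AE_I2) (simp add: space_\<mu>)
    show "AE t in \<mu> x. (\<lambda>n. (s n t)\<^sup>2) \<longlonglongrightarrow> (g t)\<^sup>2"
      by (intro AE_I2 tendsto_power lim) (simp add: space_\<mu>)
  qed (use sq in auto)
  moreover have "(\<lambda>n. (norm (simple_op (s n) x))\<^sup>2) \<longlonglongrightarrow> (norm y)\<^sup>2"
    by (intro tendsto_intros sy)
  ultimately show "(norm y)\<^sup>2 = (\<integral>t. (g t)\<^sup>2 \<partial>\<mu> x)"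
    unfolding norm_simple_op[OF s] by (rule LIMSEQ_unique[rotated])
qed

text \<open>Square integrability makes the simple approximations converge in L2, so their values at
  \<open>x\<close> are Cauchy, and completeness of the space supplies the image.\<close>

lemma SI_Domain:
  assumes g: "g \<in> borel_measurable M" and fin: "(\<integral>\<^sup>+t. ennreal ((g t)\<^sup>2) \<partial>\<mu> x) < \<infinity>"
  shows "\<exists>y. (x, y) \<in> SI g"
proof -
  obtain s where s: "\<And>n. simple_function M (s n)"
    and lim: "\<And>t. t \<in> space M \<Longrightarrow> (\<lambda>n. s n t) \<longlonglongrightarrow> g t"
    and bound: "\<And>n t. t \<in> space M \<Longrightarrow> \<bar>s n t\<bar> \<le> 2 * \<bar>g t\<bar>"
    and SI: "\<And>x y. (x, y) \<in> SI g \<longleftrightarrow> (\<lambda>n. simple_op (s n) x) \<longlonglongrightarrow> y"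
    using spectral_integral_approx[OF g] by metis
  define d where "d n = (\<integral>\<^sup>+t. ennreal ((s n t - g t)\<^sup>2) \<partial>\<mu> x)" for n
  have d: "d \<longlonglongrightarrow> 0"
    unfolding d_def by (rule dominated_\<mu>[OF s lim bound g fin])
  have "Cauchy (\<lambda>n. simple_op (s n) x)"
  proof (rule metric_CauchyI)
    fix e :: real assume "0 < e"
    \<comment> \<open>With this tolerance the bound 2 d m + 2 d n is at most e^2 / 2.\<close>
    then have "0 < ennreal (e\<^sup>2 / 8)" by simp
    from order_tendstoD(2)[OF d this] obtain N where N: "\<And>n. n \<ge> N \<Longrightarrow> d n < ennreal (e\<^sup>2 / 8)"
      by (auto simp: eventually_sequentially)
    show "\<exists>N. \<forall>m\<ge>N. \<forall>n\<ge>N. dist (simple_op (s m) x) (simple_op (s n) x) < e"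
    proof (intro exI allI impI)
      fix m n assume mn: "m \<ge> N" "n \<ge> N"
      have "ennreal ((norm (simple_op (s m) x - simple_op (s n) x))\<^sup>2) \<le> 2 * d m + 2 * d n"
        unfolding d_def by (rule norm_simple_op_diff_le[OF s s g])
      also have "\<dots> \<le> 2 * ennreal (e\<^sup>2 / 8) + 2 * ennreal (e\<^sup>2 / 8)"
        using N[OF mn(1)] N[OF mn(2)] by (intro add_mono mult_left_mono) auto
      also have "\<dots> = ennreal (2 * (e\<^sup>2 / 8) + 2 * (e\<^sup>2 / 8))"
        by (subst ennreal_plus) (simp_all only: ennreal_mult ennreal_numeral zero_le_numeral
            zero_le_divide_iff zero_le_power2 zero_le_mult_iff simp_thms)
      finally have "(norm (simple_op (s m) x - simple_op (s n) x))\<^sup>2 \<le> 2 * (e\<^sup>2 / 8) + 2 * (e\<^sup>2 / 8)"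
        by (subst (asm) ennreal_le_iff) simp_all
      also have "\<dots> < e\<^sup>2" using \<open>0 < e\<close> by simp
      finally have "(norm (simple_op (s m) x - simple_op (s n) x))\<^sup>2 < e\<^sup>2" .
      then show "dist (simple_op (s m) x) (simple_op (s n) x) < e"
        using \<open>0 < e\<close> by (simp add: dist_norm power_less_imp_less_base)
    qed
  qed
  then obtain y where "(\<lambda>n. simple_op (s n) x) \<longlonglongrightarrow> y"
    using Cauchy_convergent convergent_def by blast
  then show ?thesis by (auto simp: SI)
qed

section \<open>Estimates from bounds on the integrand\<close>

lemma SI_Domain_bounded:
  assumes g: "g \<in> borel_measurable M" and b: "AE t in \<mu> x. \<bar>g t\<bar> \<le> b"
  shows "\<exists>y. (x, y) \<in> SI g"
proof (rule SI_Domain[OF g])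
  interpret finite_measure "\<mu> x" by (rule finite_measure_\<mu>)
  have "(\<integral>\<^sup>+t. ennreal ((g t)\<^sup>2) \<partial>\<mu> x) \<le> (\<integral>\<^sup>+t. ennreal (b\<^sup>2) \<partial>\<mu> x)"
  proof (rule nn_integral_mono_AE, use b in eventually_elim)
    fix t assume "\<bar>g t\<bar> \<le> b"
    then have "\<bar>g t\<bar> \<le> \<bar>b\<bar>" by linarith
    then show "ennreal ((g t)\<^sup>2) \<le> ennreal (b\<^sup>2)" by (intro ennreal_leI) (rule abs_le_square_iff[THEN iffD1])
  qed
  also have "\<dots> < \<infinity>" by (simp add: space_\<mu> emeasure_\<mu> ennreal_mult_less_top)
  finally show "(\<integral>\<^sup>+t. ennreal ((g t)\<^sup>2) \<partial>\<mu> x) < \<infinity>" .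
qed

lemma integral_const_\<mu>: "(\<integral>t. (c::real) \<partial>\<mu> x) = c * (norm x)\<^sup>2"
  by (simp add: space_\<mu> measure_\<mu> E_space)

lemma SI_norm_le:
  assumes g: "g \<in> borel_measurable M" and xy: "(x, y) \<in> SI g" and b: "AE t in \<mu> x. \<bar>g t\<bar> \<le> b"
  shows "(norm y)\<^sup>2 \<le> b\<^sup>2 * (norm x)\<^sup>2"
proof -
  interpret finite_measure "\<mu> x" by (rule finite_measure_\<mu>)
  have "(norm y)\<^sup>2 \<le> (\<integral>t. b\<^sup>2 \<partial>\<mu> x)"
    unfolding SI_norm[OF g xy]
  proof (rule integral_mono_AE[OF SI_integrable_square[OF g xy]], simp, use b in eventually_elim)
    fix t assume "\<bar>g t\<bar> \<le> b"
    then have "\<bar>g t\<bar> \<le> \<bar>b\<bar>" by linarith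
    then show "(g t)\<^sup>2 \<le> b\<^sup>2" by (rule abs_le_square_iff[THEN iffD1])
  qed
  then show ?thesis by (simp only: integral_const_\<mu>)
qed

lemma SI_Re_cinner_ge:
  assumes g: "g \<in> borel_measurable M" and xy: "(x, y) \<in> SI g" and b: "AE t in \<mu> x. d \<le> g t"
  shows "d * (norm x)\<^sup>2 \<le> Re (cinner y x)"
proof -
  interpret finite_measure "\<mu> x" by (rule finite_measure_\<mu>)
  have "(\<integral>t. d \<partial>\<mu> x) \<le> Re (cinner y x)"
    unfolding SI_Re_cinner[OF g xy] by (rule integral_mono_AE[OF _ SI_integrable[OF g xy] b]) simp
  then show ?thesis by (simp only: integral_const_\<mu>)
qed

end

subsection \<open>Monotonicity from right derivatives\<close>

text \<open>Real induction: the supremum \<open>c\<close> of the times up to which g t - e t <= g a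
  - e a holds inherits the inequality by continuity, and if c < b the slope condition carries it
  strictly beyond \<open>c\<close>.\<close>

lemma le_if_right_slope_le:
  fixes g :: "real \<Rightarrow> real"
  assumes "a \<le> b" and cont: "continuous_on {a..b} g"
    and slope: "\<And>t. a \<le> t \<Longrightarrow> t < b \<Longrightarrow> eventually (\<lambda>s. g s \<le> g t + e * (s - t)) (at_right t)"
  shows "g b \<le> g a + e * (b - a)"
proof -
  define G where "G = {t\<in>{a..b}. g t - e * t \<le> g a - e * a}"
  \<comment> \<open>\<open>T\<close> asks for the inequality on all of [a, t], so that its supremum
    is the first point beyond which it can fail.\<close>
  define T where "T = {t\<in>{a..b}. {a..t} \<subseteq> G}"
  define c where "c = Sup T"
  have aT: "a \<in> T" using \<open>a \<le> b\<close> by (auto simp: T_def G_def)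
  have bdd: "bdd_above T" by (auto simp: T_def intro: bdd_aboveI[of _ b])
  have ac: "a \<le> c" using aT bdd by (auto simp: c_def intro: cSup_upper)
  have cb: "c \<le> b" using aT by (auto simp: c_def T_def intro!: cSup_least)
  have below: "t \<in> G" if "a \<le> t" "t < c" for t
  proof -
    from that(2) obtain t' where "t' \<in> T" "t < t'"
      unfolding c_def using less_cSup_iff[OF _ bdd] aT by blast
    then show ?thesis using that(1) by (auto simp: T_def)
  qed
  have "closed G"
    unfolding G_def by (intro continuous_on_closed_Collect_le continuous_intros cont closed_atLeastAtMost)
  have cG: "c \<in> G"
  proof (cases "a = c")
    case True then show ?thesis using \<open>a \<le> b\<close> by (auto simp: G_def)
  next
    case False
    then have "a < c" using ac by simp
    have "c \<in> closure {a..<c}" using \<open>a < c\<close> by (simp add: closure_atLeastLessThan)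
    moreover have "{a..<c} \<subseteq> G" using below by auto
    ultimately show ?thesis using \<open>closed G\<close> closure_minimal by blast
  qed
  have "c = b"
  proof (rule ccontr)
    assume "c \<noteq> b"
    then have "c < b" using cb by simp
    from slope[OF ac this] have "eventually (\<lambda>s. g s \<le> g c + e * (s - c)) (at_right c)" .
    then obtain d where d: "c < d" "\<And>s. c < s \<Longrightarrow> s < d \<Longrightarrow> g s \<le> g c + e * (s - c)"
      unfolding eventually_at_right_field by blast
    define m where "m = (c + min d b) / 2"
    have m: "c < m" "m < d" "m < b" using d(1) \<open>c < b\<close> by (auto simp: m_def min_def field_simps)
    have "t \<in> G" if "t \<in> {a..m}" for t
    proof -
      consider "t < c" | "t = c" | "c < t" by linarith
      then show ?thesis
      proof cases
        case 3
        then have "g t \<le> g c + e * (t - c)" using d(2) that m by auto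
        moreover have "g c - e * c \<le> g a - e * a" using cG by (simp add: G_def)
        ultimately show ?thesis using that m by (simp add: G_def algebra_simps)
      qed (use below cG that in auto)
    qed
    then have "m \<in> T" using m ac by (auto simp: T_def)
    then have "m \<le> c" unfolding c_def using bdd by (rule cSup_upper)
    then show False using m by simp
  qed
  then show ?thesis using cG by (simp add: G_def algebra_simps)
qed

lemma le_if_right_slope_nonpos:
  fixes g :: "real \<Rightarrow> real"
  assumes "a \<le> b" and cont: "continuous_on {a..b} g"
    and slope: "\<And>t e. a \<le> t \<Longrightarrow> t < b \<Longrightarrow> 0 < e \<Longrightarrow> eventually (\<lambda>s. g s \<le> g t + e * (s - t)) (at_right t)"
  shows "g b \<le> g a"
proof (rule field_le_epsilon)
  fix e :: real assume "0 < e"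
  \<comment> \<open>The extra 1 covers a = b and keeps e' (b - a) at most e.\<close>
  define e' where "e' = e / (b - a + 1)"
  have "0 < e'" using \<open>0 < e\<close> \<open>a \<le> b\<close> by (simp add: e'_def)
  have "g b \<le> g a + e' * (b - a)"
    by (rule le_if_right_slope_le[OF \<open>a \<le> b\<close> cont slope[OF _ _ \<open>0 < e'\<close>]])
  also have "e' * (b - a) \<le> e"
    using \<open>0 < e\<close> \<open>a \<le> b\<close> by (simp add: e'_def field_simps)
  finally show "g b \<le> g a + e" by simp
qed

lemma le_if_right_derivative_nonpos:
  fixes g :: "real \<Rightarrow> real"
  assumes "a \<le> b" and cont: "continuous_on {a..b} g"
    and deriv: "\<And>t. a \<le> t \<Longrightarrow> t < b \<Longrightarrow> \<exists>D\<le>0. (g has_vector_derivative D) (at_right t)"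
  shows "g b \<le> g a"
proof (rule le_if_right_slope_nonpos[OF \<open>a \<le> b\<close> cont])
  fix t e :: real assume t: "a \<le> t" "t < b" and "0 < e"
  from deriv[OF t] obtain D where D: "D \<le> 0" "(g has_vector_derivative D) (at_right t)" by blast
  then have "((\<lambda>s. (g s - g t) / (s - t)) \<longlongrightarrow> D) (at_right t)"
    by (simp add: has_real_derivative_iff_has_vector_derivative[symmetric] has_field_derivative_iff)
  then have "eventually (\<lambda>s. (g s - g t) / (s - t) < e) (at_right t)"
    by (rule order_tendstoD(2)) (use D(1) \<open>0 < e\<close> in simp)
  moreover have "eventually (\<lambda>s. t < s) (at_right t)"
    by (rule eventually_at_right_less)
  ultimately show "eventually (\<lambda>s. g s \<le> g t + e * (s - t)) (at_right t)"
    by eventually_elim (simp add: field_simps)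
qed

text \<open>The hypothesis has the shape of the limit in \<open>generator\<close>; after a shift of
  time it becomes the defining limit of a right derivative.\<close>

lemma has_vector_derivative_at_right:
  fixes F :: "real \<Rightarrow> 'b::real_normed_vector"
  assumes "((\<lambda>h. norm ((1 / h) *\<^sub>R (F (t + h) - F t) - D)) \<longlongrightarrow> 0) (at_right 0)"
  shows "(F has_vector_derivative D) (at_right t)"
  unfolding has_vector_derivative_def has_derivative_iff_norm
proof
  show "bounded_linear (\<lambda>x. x *\<^sub>R D)" by (rule bounded_linear_scaleR_left)
  have "((\<lambda>h. norm (F (h + t) - F t - (h + t - t) *\<^sub>R D) / norm (h + t - t)) \<longlongrightarrow> 0) (at_right 0)"
  proof (rule Lim_transform_eventually[OF assms])
    have "eventually (\<lambda>h. 0 < h) (at_right (0::real))"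
      by (rule eventually_at_right_less)
    then show "eventually (\<lambda>h. norm ((1 / h) *\<^sub>R (F (t + h) - F t) - D) =
        norm (F (h + t) - F t - (h + t - t) *\<^sub>R D) / norm (h + t - t)) (at_right 0)"
    proof eventually_elim
      fix h :: real assume "0 < h"
      then have "(1 / h) *\<^sub>R (F (t + h) - F t) - D = (1 / h) *\<^sub>R (F (h + t) - F t - h *\<^sub>R D)"
        by (simp add: scaleR_diff_right add.commute)
      then show "norm ((1 / h) *\<^sub>R (F (t + h) - F t) - D) =
        norm (F (h + t) - F t - (h + t - t) *\<^sub>R D) / norm (h + t - t)"
        using \<open>0 < h\<close> by simp
    qed
  qed
  then show "((\<lambda>y. norm (F y - F t - (y - t) *\<^sub>R D) / norm (y - t)) \<longlongrightarrow> 0) (at_right t)"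
    by (subst filterlim_at_right_to_0)
qed

subsection \<open>Contraction semigroups\<close>

text \<open>The norm is given as the pullback of the norm of \<open>'c\<close> by a linear map \<open>L\<close>.\<close>

locale contraction_sg =
  fixes X :: "'b::complex_vector set" and L :: "'b \<Rightarrow> 'c::real_normed_vector"
    and S :: "real \<Rightarrow> 'b \<Rightarrow> 'b"
  assumes sg: "contraction_semigroup X (\<lambda>z. norm (L z)) S"
    and X_add: "z \<in> X \<Longrightarrow> w \<in> X \<Longrightarrow> z + w \<in> X"
    and X_scaleC: "z \<in> X \<Longrightarrow> c *\<^sub>C z \<in> X"
    and L_add: "z \<in> X \<Longrightarrow> w \<in> X \<Longrightarrow> L (z + w) = L z + L w"
    and L_scaleR: "z \<in> X \<Longrightarrow> L (r *\<^sub>R z) = r *\<^sub>R L z"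
begin

abbreviation gen :: "('b \<times> 'b) set" where
  "gen \<equiv> generator X (\<lambda>z. norm (L z)) S"

lemma X_scaleR: "z \<in> X \<Longrightarrow> r *\<^sub>R z \<in> X"
  using X_scaleC[of z "complex_of_real r"] by (simp add: scaleC_of_real)

lemma X_diff: "z \<in> X \<Longrightarrow> w \<in> X \<Longrightarrow> z - w \<in> X"
  using X_add[of z "- w"] X_scaleR[of w "-1"] by simp

lemma L_diff: "z \<in> X \<Longrightarrow> w \<in> X \<Longrightarrow> L (z - w) = L z - L w"
  using L_add[of z "- w"] X_scaleR[of w "-1"] L_scaleR[of w "-1"] by simp

lemma S_X: "0 \<le> t \<Longrightarrow> z \<in> X \<Longrightarrow> S t z \<in> X"
  and S_0: "z \<in> X \<Longrightarrow> S 0 z = z"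
  and S_plus: "0 \<le> s \<Longrightarrow> 0 \<le> t \<Longrightarrow> z \<in> X \<Longrightarrow> S (s + t) z = S s (S t z)"
  and S_add: "0 \<le> t \<Longrightarrow> z \<in> X \<Longrightarrow> w \<in> X \<Longrightarrow> S t (z + w) = S t z + S t w"
  and S_contraction: "0 \<le> t \<Longrightarrow> z \<in> X \<Longrightarrow> norm (L (S t z)) \<le> norm (L z)"
  and S_right_continuous: "z \<in> X \<Longrightarrow> ((\<lambda>t. norm (L (S t z - z))) \<longlongrightarrow> 0) (at_right 0)"
  using sg by (simp_all add: contraction_semigroup_def)

lemma S_scaleR:
  assumes "0 \<le> t" "z \<in> X"
  shows "S t (r *\<^sub>R z) = r *\<^sub>R S t z"
proof -
  have "S t (complex_of_real r *\<^sub>C z) = complex_of_real r *\<^sub>C S t z"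
    using sg assms by (simp add: contraction_semigroup_def)
  then show ?thesis by (simp add: scaleC_of_real)
qed

lemma S_diff: "0 \<le> t \<Longrightarrow> z \<in> X \<Longrightarrow> w \<in> X \<Longrightarrow> S t (z - w) = S t z - S t w"
  using S_add[of t z "- w"] X_scaleR[of w "-1"] S_scaleR[of t w "-1"] by simp

lemma S_decreasing:
  assumes "0 \<le> s" "s \<le> t" "z \<in> X"
  shows "norm (L (S t z)) \<le> norm (L (S s z))"
  using S_contraction[of "t - s" "S s z"] S_plus[of "t - s" s z] S_X[of s z] assms by simp

text \<open>Contractivity reduces S b z - S a z for a < b to S (b - a) z - z, so right continuity at
  0 gives one modulus of continuity for all times, from both sides.\<close>

lemma continuous_on_orbit:
  assumes z: "z \<in> X"
  shows "continuous_on {0..} (\<lambda>t. L (S t z))"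
  unfolding continuous_on_iff
proof (intro ballI allI impI)
  fix t e :: real assume t: "t \<in> {0..}" and "0 < e"
  from order_tendstoD(2)[OF S_right_continuous[OF z] \<open>0 < e\<close>]
  obtain d where d: "0 < d" "\<And>h. 0 < h \<Longrightarrow> h < d \<Longrightarrow> norm (L (S h z - z)) < e"
    unfolding eventually_at_right_field by auto
  have le: "norm (L (S b z) - L (S a z)) < e" if "0 \<le> a" "a < b" "b < a + d" for a b
  proof -
    have "S b z - S a z = S a (S (b - a) z - z)"
      using S_plus[of a "b - a" z] S_diff[of a "S (b - a) z" z] z S_X[of "b - a" z] that by simp
    then have "norm (L (S b z) - L (S a z)) \<le> norm (L (S (b - a) z - z))"
      using S_contraction[of a "S (b - a) z - z"] L_diff[of "S b z" "S a z"] z that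
      by (simp add: S_X X_diff)
    also have "\<dots> < e" using d(2) that by simp
    finally show ?thesis .
  qed
  show "\<exists>d>0. \<forall>x'\<in>{0..}. dist x' t < d \<longrightarrow> dist (L (S x' z)) (L (S t z)) < e"
  proof (intro exI[of _ d] conjI ballI impI)
    fix s assume s: "s \<in> {0..}" "dist s t < d"
    consider "s < t" | "s = t" | "t < s" by linarith
    then show "dist (L (S s z)) (L (S t z)) < e"
    proof cases
      case 1
      then show ?thesis using le[of s t] s t by (simp add: dist_norm norm_minus_commute)
    next
      case 3
      then show ?thesis using le[of t s] s t by (simp add: dist_norm)
    qed (use \<open>0 < e\<close> in simp)
  qed fact
qed

text \<open>\<open>S t\<close> commutes with every \<open>S h\<close> and is a contraction, so the
  error of the difference quotient at \<open>S t z\<close> is at most the error at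
  \<open>z\<close>.\<close>

lemma gen_S:
  assumes zw: "(z, w) \<in> gen" and t: "0 \<le> t"
  shows "(S t z, S t w) \<in> gen"
proof -
  have X: "z \<in> X" "w \<in> X" and
    lim: "((\<lambda>h. norm (L ((1 / h) *\<^sub>R (S h z - z) - w))) \<longlongrightarrow> 0) (at_right 0)"
    using zw by (auto simp: generator_def)
  have "((\<lambda>h. norm (L ((1 / h) *\<^sub>R (S h (S t z) - S t z) - S t w))) \<longlongrightarrow> 0) (at_right 0)"
  proof (rule tendsto_sandwich[OF _ _ tendsto_const lim])
    have "eventually (\<lambda>h. 0 < h) (at_right (0::real))"
      by (rule eventually_at_right_less)
    then show "eventually (\<lambda>h. norm (L ((1 / h) *\<^sub>R (S h (S t z) - S t z) - S t w))
        \<le> norm (L ((1 / h) *\<^sub>R (S h z - z) - w))) (at_right 0)"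
    proof eventually_elim
      fix h :: real assume h: "0 < h"
      have "S h (S t z) = S t (S h z)"
        using S_plus[of h t z] S_plus[of t h z] h t X by (simp add: add.commute)
      then have "(1 / h) *\<^sub>R (S h (S t z) - S t z) - S t w = S t ((1 / h) *\<^sub>R (S h z - z) - w)"
        using h t X by (simp add: S_diff S_scaleR S_X X_diff X_scaleR)
      then show "norm (L ((1 / h) *\<^sub>R (S h (S t z) - S t z) - S t w))
        \<le> norm (L ((1 / h) *\<^sub>R (S h z - z) - w))"
        using h t X by (simp add: S_contraction S_X X_diff X_scaleR)
    qed
  qed simp
  then show ?thesis using X t by (simp add: generator_def S_X)
qed

text \<open>Meant for components of an orbit measured in a norm weaker than the phase norm, such as
  the displacement in H.\<close>

lemma continuous_on_orbit_comp:
  fixes J :: "'b \<Rightarrow> 'd::real_normed_vector"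
  assumes z: "z \<in> X"
    and J_diff: "\<And>z w. z \<in> X \<Longrightarrow> w \<in> X \<Longrightarrow> J (z - w) = J z - J w"
    and J_le: "\<And>z. z \<in> X \<Longrightarrow> norm (J z) \<le> C * norm (L z)"
  shows "continuous_on {0..} (\<lambda>t. J (S t z))"
  unfolding continuous_on_def
proof
  fix t :: real assume t: "t \<in> {0..}"
  then have "((\<lambda>s. L (S s z)) \<longlongrightarrow> L (S t z)) (at t within {0..})"
    using continuous_on_orbit[OF z] by (simp add: continuous_on_def)
  then have "((\<lambda>s. C * norm (L (S s z) - L (S t z))) \<longlongrightarrow> 0) (at t within {0..})"
    by (intro tendsto_mult_right_zero tendsto_norm_zero) (simp add: LIM_zero)
  moreover have "eventually (\<lambda>s. s \<in> {0..}) (at t within {0..})"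
    by (simp add: eventually_at_filter)
  then have "eventually (\<lambda>s. norm (J (S s z) - J (S t z)) \<le> C * norm (L (S s z) - L (S t z))) (at t within {0..})"
  proof eventually_elim
    fix s :: real assume "s \<in> {0..}"
    then show "norm (J (S s z) - J (S t z)) \<le> C * norm (L (S s z) - L (S t z))"
      using J_le[of "S s z - S t z"] t z by (simp add: J_diff L_diff S_X X_diff)
  qed
  ultimately have "((\<lambda>s. J (S s z) - J (S t z)) \<longlongrightarrow> 0) (at t within {0..})"
    by (rule Lim_null_comparison[rotated])
  then show "((\<lambda>s. J (S s z)) \<longlongrightarrow> J (S t z)) (at t within {0..})"
    by (rule LIM_zero_cancel)
qed

lemma orbit_derivative_comp:
  fixes J :: "'b \<Rightarrow> 'd::real_normed_vector"
  assumes t: "0 \<le> t" and z: "z \<in> X" and w: "(S t z, w) \<in> gen"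
    and J_diff: "\<And>z w. z \<in> X \<Longrightarrow> w \<in> X \<Longrightarrow> J (z - w) = J z - J w"
    and J_scaleR: "\<And>z r. z \<in> X \<Longrightarrow> J (r *\<^sub>R z) = r *\<^sub>R J z"
    and J_le: "\<And>z. z \<in> X \<Longrightarrow> norm (J z) \<le> C * norm (L z)"
  shows "((\<lambda>t. J (S t z)) has_vector_derivative J w) (at_right t)"
proof (rule has_vector_derivative_at_right)
  have wX: "w \<in> X" and
    lim: "((\<lambda>h. norm (L ((1 / h) *\<^sub>R (S h (S t z) - S t z) - w))) \<longlongrightarrow> 0) (at_right 0)"
    using w by (auto simp: generator_def)
  from lim have lim: "((\<lambda>h. C * norm (L ((1 / h) *\<^sub>R (S h (S t z) - S t z) - w))) \<longlongrightarrow> 0) (at_right 0)"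
    by (rule tendsto_mult_right_zero)
  show "((\<lambda>h. norm ((1 / h) *\<^sub>R (J (S (t + h) z) - J (S t z)) - J w)) \<longlongrightarrow> 0) (at_right 0)"
  proof (rule tendsto_sandwich[OF _ _ tendsto_const lim])
    have "eventually (\<lambda>h. 0 < h) (at_right (0::real))"
      by (rule eventually_at_right_less)
    then show "eventually (\<lambda>h. norm ((1 / h) *\<^sub>R (J (S (t + h) z) - J (S t z)) - J w)
        \<le> C * norm (L ((1 / h) *\<^sub>R (S h (S t z) - S t z) - w))) (at_right 0)"
    proof eventually_elim
      fix h :: real assume h: "0 < h"
      have "S (t + h) z = S h (S t z)"
        using S_plus[of h t z] h t z by (simp add: add.commute)
      then show "norm ((1 / h) *\<^sub>R (J (S (t + h) z) - J (S t z)) - J w)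
        \<le> C * norm (L ((1 / h) *\<^sub>R (S h (S t z) - S t z) - w))"
        using J_le[of "(1 / h) *\<^sub>R (S h (S t z) - S t z) - w"] h t z wX
        by (simp add: J_diff J_scaleR S_X X_diff X_scaleR)
    qed
  qed simp
qed

text \<open>
  If \<open>(z, w)\<close> is in the generator, then so is \<open>(Q z, Q w)\<close>, hence \<open>Q S(t + h) z\<close> is close to
  \<open>S(h) Q S(t) z\<close> and the norm of \<open>Q S(t) z\<close> cannot increase to first order.
\<close>

lemma commuting_norm_decreasing:
  assumes Q_X: "\<And>z. z \<in> X \<Longrightarrow> Q z \<in> X"
    and Q_diff: "\<And>z w. z \<in> X \<Longrightarrow> w \<in> X \<Longrightarrow> Q (z - w) = Q z - Q w"
    and Q_scaleR: "\<And>z r. z \<in> X \<Longrightarrow> Q (r *\<^sub>R z) = r *\<^sub>R Q z"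
    and Q_le: "\<And>z. z \<in> X \<Longrightarrow> norm (L (Q z)) \<le> norm (L z)"
    and Q_gen: "\<And>z w. (z, w) \<in> gen \<Longrightarrow> (Q z, Q w) \<in> gen"
    and zw: "(z, w) \<in> gen" and T: "0 \<le> T"
  shows "norm (L (Q (S T z))) \<le> norm (L (Q z))"
proof -
  have z: "z \<in> X" using zw by (simp add: generator_def)
  have "norm (L (Q (S T z))) \<le> norm (L (Q (S 0 z)))"
  proof (rule le_if_right_slope_nonpos[OF T])
    show "continuous_on {0..T} (\<lambda>t. norm (L (Q (S t z))))"
      unfolding continuous_on_iff
    proof (intro ballI allI impI)
      fix t e :: real assume t: "t \<in> {0..T}" and "0 < e"
      with continuous_on_orbit[OF z] obtain d where d: "0 < d"
        "\<And>s. 0 \<le> s \<Longrightarrow> dist s t < d \<Longrightarrow> dist (L (S s z)) (L (S t z)) < e"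
        unfolding continuous_on_iff by (metis atLeastAtMost_iff atLeast_iff)
      show "\<exists>d>0. \<forall>s\<in>{0..T}. dist s t < d \<longrightarrow> dist (norm (L (Q (S s z)))) (norm (L (Q (S t z)))) < e"
      proof (intro exI[of _ d] conjI ballI impI)
        fix s assume s: "s \<in> {0..T}" "dist s t < d"
        have "dist (norm (L (Q (S s z)))) (norm (L (Q (S t z)))) \<le> norm (L (Q (S s z)) - L (Q (S t z)))"
          by (simp add: dist_real_def norm_triangle_ineq3)
        also have "\<dots> = norm (L (Q (S s z - S t z)))"
          using s t z by (simp add: L_diff Q_diff Q_X S_X)
        also have "\<dots> \<le> norm (L (S s z - S t z))"
          using s t z by (simp add: Q_le X_diff S_X)
        also have "\<dots> = dist (L (S s z)) (L (S t z))"
          using s t z by (simp add: L_diff S_X dist_norm)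
        also have "\<dots> < e" using d(2) s by simp
        finally show "dist (norm (L (Q (S s z)))) (norm (L (Q (S t z)))) < e" .
      qed fact
    qed
  next
    fix t e :: real assume t: "0 \<le> t" "t < T" and "0 < e"
    define y where "y = S t z"
    define w' where "w' = S t w"
    have gen: "(y, w') \<in> gen" unfolding y_def w'_def using gen_S[OF zw] t by simp
    have X: "y \<in> X" "w' \<in> X"
      and l1: "((\<lambda>h. norm (L ((1 / h) *\<^sub>R (S h y - y) - w'))) \<longlongrightarrow> 0) (at_right 0)"
      using gen by (auto simp: generator_def)
    have l2: "((\<lambda>h. norm (L ((1 / h) *\<^sub>R (S h (Q y) - Q y) - Q w'))) \<longlongrightarrow> 0) (at_right 0)"
      using Q_gen[OF gen] by (auto simp: generator_def)
    have "0 < e / 2" using \<open>0 < e\<close> by simp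
    note order_tendstoD(2)[OF l1 this] order_tendstoD(2)[OF l2 this]
    moreover have "eventually (\<lambda>h. 0 < h) (at_right (0::real))"
      by (rule eventually_at_right_less)
    ultimately have "eventually (\<lambda>h. norm (L (Q (S (h + t) z))) \<le> norm (L (Q (S t z))) + e * (h + t - t)) (at_right 0)"
    proof eventually_elim
      fix h :: real
      let ?a = "(1 / h) *\<^sub>R (S h y - y) - w'" and ?b = "(1 / h) *\<^sub>R (S h (Q y) - Q y) - Q w'"
      assume a: "norm (L ?a) < e / 2" and b: "norm (L ?b) < e / 2" and h: "0 < h"
      have aX: "?a \<in> X" and bX: "?b \<in> X" using X h by (simp_all add: X_diff X_scaleR S_X Q_X)
      \<comment> \<open>\<open>Q y\<close> and \<open>Q w'\<close> cancel in
        \<open>Q ?a - ?b\<close>, so \<open>h\<close> times this difference is the commutator of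
        \<open>Q\<close> and \<open>S h\<close> at \<open>y\<close>. Each of the two errors gets
        half of \<open>e\<close>.\<close>
      have "Q (S (h + t) z) = S h (Q y) + h *\<^sub>R (Q ?a - ?b)"
        using S_plus[of h t z] h t z X
        by (simp add: y_def[symmetric] Q_diff Q_scaleR X_diff X_scaleR S_X scaleR_diff_right)
      then have "L (Q (S (h + t) z)) = L (S h (Q y)) + h *\<^sub>R (L (Q ?a) - L ?b)"
        using h X aX bX by (simp only: L_add L_scaleR L_diff X_diff X_scaleR S_X Q_X less_imp_le)
      then have "norm (L (Q (S (h + t) z))) \<le> norm (L (S h (Q y))) + h * (norm (L (Q ?a)) + norm (L ?b))"
        using h by (smt (verit) norm_triangle_ineq norm_triangle_ineq4 norm_scaleR mult_left_mono)
      also have "norm (L (S h (Q y))) \<le> norm (L (Q y))"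
        using h X by (simp add: S_contraction Q_X)
      also have "norm (L (Q ?a)) + norm (L ?b) \<le> e / 2 + e / 2"
        using Q_le[OF aX] a b by linarith
      finally show "norm (L (Q (S (h + t) z))) \<le> norm (L (Q (S t z))) + e * (h + t - t)"
        using h by (simp add: y_def mult.commute)
    qed
    then show "eventually (\<lambda>s. norm (L (Q (S s z))) \<le> norm (L (Q (S t z))) + e * (s - t)) (at_right t)"
      by (subst eventually_at_right_to_0)
  qed
  then show ?thesis by (simp add: S_0[OF z])
qed

end

subsection \<open>The damped wave equation\<close>

locale spectral_wave =
  fixes A :: "('a::complex_hilbert \<times> 'a) set" and E :: "real set \<Rightarrow> 'a \<Rightarrow> 'a" and f :: "real \<Rightarrow> real"
  assumes pos: "strictly_positive A"
    and spec: "is_spectral_measure A E"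
    and f_cont: "continuous_on (real_spectrum A) f"
    and f_nonneg: "\<forall>s\<in>real_spectrum A. 0 \<le> f s"
begin

section \<open>The spectral measure of A and its spectral gap\<close>

sublocale pvm "spectrum_borel A" E
  using spec by unfold_locales (simp add: is_spectral_measure_def)

abbreviation M :: "real measure" where
  "M \<equiv> spectrum_borel A"

abbreviation rt :: "real \<Rightarrow> real" where
  "rt \<equiv> \<lambda>s. s powr (1 / 2)"

lemma SI_id: "SI (\<lambda>s. s) = A"
  using spec by (simp add: is_spectral_measure_def)

lemma measurable_id: "(\<lambda>s. s) \<in> borel_measurable M"
  by (rule measurable_restrict_space1) simp

lemma measurable_rt: "rt \<in> borel_measurable M"
  by (rule measurable_restrict_space1) measurable

lemma measurable_f: "f \<in> borel_measurable M"
  using f_cont by (rule borel_measurable_continuous_on_restrict)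

lemma space_M: "space M = real_spectrum A"
  by (simp add: space_restrict_space)

lemmas A_add = SI_add[OF measurable_id, unfolded SI_id]
lemmas A_E = SI_E[OF measurable_id, unfolded SI_id]
lemmas A_sym = SI_sym[OF measurable_id, unfolded SI_id]

text \<open>
  A vector in the range of \<open>E {s. s < c}\<close> on which \<open>A\<close> is bounded violates strict positivity.
\<close>

lemma spectral_gap: "\<exists>c>0. \<forall>x. AE s in \<mu> x. c \<le> s"
proof -
  obtain c where c: "0 < c" "\<And>x y. (x, y) \<in> A \<Longrightarrow> c * (norm x)\<^sup>2 \<le> Re (cinner y x)"
    using pos unfolding strictly_positive_def by blast
  define B where "B n = {s \<in> space M. s < c \<and> \<bar>s\<bar> \<le> real n}" for n
  have B: "B n \<in> sets M" for n
  proof -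
    have "{s \<in> space M. (\<lambda>s. s) s < c \<and> \<bar>(\<lambda>s. s) s\<bar> \<le> real n} \<in> sets M"
      using measurable_id by measurable
    then show ?thesis by (simp add: B_def)
  qed
  have E0: "E (B n) x = 0" for n x
  proof -
    define y where "y = E (B n) x"
    have "E (B n) y = y" by (simp add: y_def E_idem[OF B])
    from AE_\<mu>_range[OF B this] have ae: "AE s in \<mu> y. s \<in> B n" .
    then have "AE s in \<mu> y. \<bar>s\<bar> \<le> real n" by eventually_elim (simp add: B_def)
    from SI_Domain_bounded[OF measurable_id this] obtain a where a: "(y, a) \<in> A"
      by (auto simp: SI_id)
    have a': "(y, a) \<in> SI (\<lambda>s. s)" using a by (simp add: SI_id)
    interpret finite_measure "\<mu> y" by (rule finite_measure_\<mu>)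
    have i: "integrable (\<mu> y) (\<lambda>s. s)" by (rule SI_integrable[OF measurable_id a'])
    then have i': "integrable (\<mu> y) (\<lambda>s. c - s)" by simp
    \<comment> \<open>On \<open>B n\<close> the integrand is positive, so its integral is
      nonnegative, while strict positivity makes it nonpositive. Hence c - s vanishes almost
      everywhere, which s < c permits only for y = 0.\<close>
    have "(\<integral>s. c - s \<partial>\<mu> y) = c * (norm y)\<^sup>2 - Re (cinner a y)"
      using i by (simp add: SI_Re_cinner[OF measurable_id a'] integral_const_\<mu> del: integral_const lebesgue_integral_const)
    then have "(\<integral>s. c - s \<partial>\<mu> y) \<le> 0" using c(2)[OF a] by simp
    moreover have nonneg: "AE s in \<mu> y. 0 \<le> c - s" using ae by eventually_elim (simp add: B_def)
    ultimately have "(\<integral>s. c - s \<partial>\<mu> y) = 0"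
      using integral_nonneg_AE[OF nonneg] by simp
    then have "AE s in \<mu> y. c - s = 0"
      using integral_nonneg_eq_0_iff_AE[OF i' nonneg] by simp
    then have "AE s in \<mu> y. s \<notin> space M" using ae by eventually_elim (simp add: B_def)
    moreover have "{s \<in> space M. \<not> s \<notin> space M} = space M" by blast
    ultimately have "y = 0" by (subst (asm) AE_\<mu>_iff) (simp_all add: E_space)
    then show ?thesis by (simp add: y_def)
  qed
  have "AE s in \<mu> x. c \<le> s" for x
  proof -
    have "AE s in \<mu> x. s \<notin> B n" for n
    proof (subst AE_\<mu>_iff)
      have "{s \<in> space M. \<not> s \<notin> B n} = B n" by (auto simp: B_def)
      then show "{s \<in> space M. \<not> s \<notin> B n} \<in> sets M" "E {s \<in> space M. \<not> s \<notin> B n} x = 0"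
        using B E0 by simp_all
    qed
    then have "AE s in \<mu> x. \<forall>n. s \<notin> B n" by (simp add: AE_all_countable)
    with AE_space show ?thesis
    proof eventually_elim
      fix s assume s: "s \<in> space (\<mu> x)" "\<forall>n. s \<notin> B n"
      obtain n where "\<bar>s\<bar> \<le> real n" using real_arch_simple by blast
      with s show "c \<le> s" by (force simp: B_def space_\<mu>)
    qed
  qed
  with c(1) show ?thesis by blast
qed

section \<open>The form domain and the square root of A\<close>

definition H1 :: "'a set" where
  "H1 = Domain (SI rt)"

text \<open>The square root of \<open>A\<close> as a total function; because \<open>op_app\<close>
  is a definite description, its values are meaningful on \<open>H1\<close> only.\<close>

definition R :: "'a \<Rightarrow> 'a" where
  "R u = op_app (SI rt) u"

lemma sobolev_space_eq: "sobolev_space A E 1 = H1"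
  by (simp add: sobolev_space_def fun_calc_def H1_def)

lemma R_eq: "(u, y) \<in> SI rt \<Longrightarrow> R u = y"
  unfolding R_def op_app_def using SI_unique[OF measurable_rt] by blast

lemma R_SI: "u \<in> H1 \<Longrightarrow> (u, R u) \<in> SI rt"
  unfolding H1_def using R_eq by blast

lemma H1_I: "(u, y) \<in> SI rt \<Longrightarrow> u \<in> H1"
  unfolding H1_def by blast

lemma R_add: "u \<in> H1 \<Longrightarrow> v \<in> H1 \<Longrightarrow> u + v \<in> H1 \<and> R (u + v) = R u + R v"
  using SI_add[OF measurable_rt R_SI R_SI] R_eq H1_I by blast

lemma R_scaleC: "u \<in> H1 \<Longrightarrow> a *\<^sub>C u \<in> H1 \<and> R (a *\<^sub>C u) = a *\<^sub>C R u"
  using SI_scaleC[OF measurable_rt R_SI] R_eq H1_I by blast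

lemma R_scaleR: "u \<in> H1 \<Longrightarrow> r *\<^sub>R u \<in> H1 \<and> R (r *\<^sub>R u) = r *\<^sub>R R u"
  using R_scaleC[of u "complex_of_real r"] by (simp add: scaleC_of_real)

lemma R_E: "u \<in> H1 \<Longrightarrow> B \<in> sets M \<Longrightarrow> E B u \<in> H1 \<and> R (E B u) = E B (R u)"
  using SI_E[OF measurable_rt R_SI] R_eq H1_I by blast

text \<open>A Poincare inequality. The spectral gap gives c <= s = (rt s)^2 almost everywhere, and
  integration yields the constant 1 / sqrt c. It lets the phase norm control \<open>u\<close> in H
  and makes \<open>L\<close> injective.\<close>

lemma norm_R_ge: "\<exists>C>0. \<forall>u\<in>H1. norm u \<le> C * norm (R u)"
proof -
  obtain c where c: "0 < c" "\<And>x. AE s in \<mu> x. c \<le> s" using spectral_gap by blast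
  have "norm u \<le> (1 / sqrt c) * norm (R u)" if "u \<in> H1" for u
  proof -
    interpret finite_measure "\<mu> u" by (rule finite_measure_\<mu>)
    note RS = R_SI[OF that]
    have "(\<integral>s. c \<partial>\<mu> u) \<le> (\<integral>s. (rt s)\<^sup>2 \<partial>\<mu> u)"
    proof (rule integral_mono_AE[OF _ SI_integrable_square[OF measurable_rt RS]])
      show "AE s in \<mu> u. c \<le> (rt s)\<^sup>2"
        using c(2)[of u] by eventually_elim (use c(1) in \<open>simp add: powr_half_sqrt\<close>)
    qed simp
    then have "c * (norm u)\<^sup>2 \<le> (norm (R u))\<^sup>2"
      by (simp only: integral_const_\<mu> SI_norm[OF measurable_rt RS])
    then have "(sqrt c * norm u)\<^sup>2 \<le> (norm (R u))\<^sup>2"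
      using c(1) by (simp add: power_mult_distrib)
    then have "sqrt c * norm u \<le> norm (R u)"
      by (rule power2_le_imp_le) simp
    then show ?thesis using c(1) by (simp add: field_simps)
  qed
  moreover have "0 < 1 / sqrt c" using c(1) by simp
  ultimately show ?thesis by blast
qed

lemma Domain_A_norm_R:
  assumes "(u, a) \<in> A"
  shows "u \<in> H1 \<and> (norm (R u))\<^sup>2 = Re (cinner a u)"
proof -
  obtain c where c: "0 < c" "\<And>x. AE s in \<mu> x. c \<le> s" using spectral_gap by blast
  have a: "(u, a) \<in> SI (\<lambda>s. s)" using assms by (simp add: SI_id)
  \<comment> \<open>\<open>rt\<close> squares to the identity only at nonnegative \<open>s\<close>;
    the gap secures this almost everywhere.\<close>
  have ae: "AE s in \<mu> u. (rt s)\<^sup>2 = s"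
    using c(2)[of u] by eventually_elim (use c(1) in \<open>simp add: powr_half_sqrt\<close>)
  have i: "integrable (\<mu> u) (\<lambda>s. s)" by (rule SI_integrable[OF measurable_id a])
  have "(\<integral>\<^sup>+s. ennreal ((rt s)\<^sup>2) \<partial>\<mu> u) = (\<integral>\<^sup>+s. ennreal s \<partial>\<mu> u)"
    by (rule nn_integral_cong_AE) (use ae in eventually_elim, simp)
  also have "\<dots> < \<infinity>"
    using nn_integral_eq_integral[OF i] c by (smt (verit) AE_mp AE_I2 ennreal_less_top infinity_ennreal_def)
  finally obtain y where y: "(u, y) \<in> SI rt" using SI_Domain[OF measurable_rt] by blast
  then have u: "u \<in> H1" by (rule H1_I)
  have "(\<integral>s. (rt s)\<^sup>2 \<partial>\<mu> u) = (\<integral>s. s \<partial>\<mu> u)"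
    using ae SI_integrable_square[OF measurable_rt y] i by (intro integral_cong_AE) auto
  then have "(norm (R u))\<^sup>2 = Re (cinner a u)"
    by (simp only: SI_norm[OF measurable_rt R_SI[OF u]] SI_Re_cinner[OF measurable_id a])
  with u show ?thesis by blast
qed

text \<open>Polarisation of the form identity, with symmetry of \<open>A\<close>; it stands in for
  \<open>A\<close> being the square of \<open>R\<close>.\<close>

lemma Re_cinner_R:
  assumes u: "(u, a) \<in> A" and v: "(v, b) \<in> A"
  shows "Re (cinner (R u) (R v)) = Re (cinner a v)"
proof -
  note Ru = Domain_A_norm_R[OF u] and Rv = Domain_A_norm_R[OF v]
  have "(norm (R u + R v))\<^sup>2 = Re (cinner (a + b) (u + v))"
    using Domain_A_norm_R[OF A_add[OF u v]] R_add[of u v] Ru Rv by simp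
  moreover have "Re (cinner b u) = Re (cinner a v)"
    using A_sym[OF u v] Re_cinner_commute[of b u] by simp
  ultimately show ?thesis
    using Ru Rv by (simp add: norm_add_square cinner_add_left cinner_add_right)
qed

text \<open>An embedding into the product Hilbert space whose norm pulls back to the phase norm, as
  \<open>contraction_sg\<close> expects.\<close>

definition L :: "'a \<times> 'a \<Rightarrow> 'a \<times> 'a" where
  "L z = (R (fst z), snd z)"

lemma phase_space_eq: "phase_space A E = H1 \<times> UNIV"
  by (simp add: phase_space_def sobolev_space_eq)

lemma phase_norm_eq: "phase_norm A E = (\<lambda>z. norm (L z))"
  by (rule ext) (simp add: phase_norm_def sobolev_norm_def fun_calc_def L_def R_def norm_prod_def)

section \<open>Spectral projections and the wave operator\<close>

definition Q :: "real set \<Rightarrow> 'a \<times> 'a \<Rightarrow> 'a \<times> 'a" where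
  "Q B z = (E B (fst z), E B (snd z))"

text \<open>In the duality identity the projection moves from \<open>u\<close>, \<open>v\<close>,
  \<open>h\<close> to the test vector: \<open>E B w\<close> lies again in both domains, and its
  images are the projections of \<open>a\<close> and \<open>b\<close>.\<close>

lemma Q_wave_operator:
  assumes B: "B \<in> sets M" and "(z, w) \<in> wave_operator A E f"
  shows "(Q B z, Q B w) \<in> wave_operator A E f"
proof -
  obtain u v h where z: "z = (u, v)" "w = (v, - h)" and H: "u \<in> H1" "v \<in> H1"
    and eq: "\<And>w a b. (w, a) \<in> A \<Longrightarrow> (w, b) \<in> SI f \<Longrightarrow> cinner a u + cinner b v = cinner w h"
    using assms(2) unfolding wave_operator_def phase_space_eq sobolev_space_eq fun_calc_def by blast
  have "cinner a (E B u) + cinner b (E B v) = cinner w (E B h)" if "(w, a) \<in> A" "(w, b) \<in> SI f" for w a b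
    using eq[OF A_E[OF that(1) B] SI_E[OF measurable_f that(2) B]] by (simp add: E_sym[OF B])
  moreover have "Q B z = (E B u, E B v)" "Q B w = (E B v, - E B h)"
    by (simp_all add: Q_def z E_minus[OF B])
  ultimately show ?thesis
    unfolding wave_operator_def phase_space_eq sobolev_space_eq fun_calc_def
    using R_E[OF H(1) B] R_E[OF H(2) B] by blast
qed

text \<open>When \<open>Au\<close> and \<open>f(A)v\<close> exist as vectors, symmetry of both
  operators turns them into the functionals of the duality formulation.\<close>

lemma wave_operator_I:
  assumes "(u, a) \<in> A" "(v, b) \<in> SI f" "v \<in> H1"
  shows "((u, v), (v, - (a + b))) \<in> wave_operator A E f"
proof -
  have "cinner a' u + cinner b' v = cinner w (a + b)" if "(w, a') \<in> A" "(w, b') \<in> SI f" for w a' b'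
    using A_sym[OF that(1) assms(1)] SI_sym[OF measurable_f that(2) assms(2)]
    by (simp add: cinner_add_right)
  then show ?thesis
    unfolding wave_operator_def phase_space_eq sobolev_space_eq fun_calc_def
    using Domain_A_norm_R[OF assms(1)] assms(3) by blast
qed

lemma range_E_A:
  assumes B: "B \<in> sets M" and b: "\<And>s. s \<in> B \<Longrightarrow> \<bar>s\<bar> \<le> b" and x: "E B x = x"
  obtains a where "(x, a) \<in> A"
proof -
  have "AE s in \<mu> x. \<bar>s\<bar> \<le> b"
    using AE_\<mu>_range[OF B x] by eventually_elim (rule b)
  from SI_Domain_bounded[OF measurable_id this] show thesis using that by (auto simp: SI_id)
qed

lemma range_E_f:
  assumes B: "B \<in> sets M" and b: "\<And>s. s \<in> B \<Longrightarrow> f s \<le> b" and d: "\<And>s. s \<in> B \<Longrightarrow> d \<le> f s" and x: "E B x = x"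
  obtains y where "(x, y) \<in> SI f" "(norm y)\<^sup>2 \<le> b\<^sup>2 * (norm x)\<^sup>2" "d * (norm x)\<^sup>2 \<le> Re (cinner y x)"
proof -
  have "B \<subseteq> real_spectrum A" using sets.sets_into_space[OF B] by (simp add: space_M)
  then have fb: "\<bar>f s\<bar> \<le> b" if "s \<in> B" for s using that f_nonneg b[of s] by auto
  have 1: "AE s in \<mu> x. \<bar>f s\<bar> \<le> b"
    using AE_\<mu>_range[OF B x] by eventually_elim (rule fb)
  have 2: "AE s in \<mu> x. d \<le> f s"
    using AE_\<mu>_range[OF B x] by eventually_elim (rule d)
  from SI_Domain_bounded[OF measurable_f 1] obtain y where "(x, y) \<in> SI f" by blast
  then show thesis
    using that SI_norm_le[OF measurable_f _ 1] SI_Re_cinner_ge[OF measurable_f _ 2] by blast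
qed

end

locale damped_wave = spectral_wave A E f
  for A :: "('a::complex_hilbert \<times> 'a) set" and E f +
  fixes S :: "real \<Rightarrow> 'a \<times> 'a \<Rightarrow> 'a \<times> 'a"
  assumes semigroup: "contraction_semigroup (phase_space A E) (phase_norm A E) S"
    and generator: "generator (phase_space A E) (phase_norm A E) S = wave_operator A E f"
begin

section \<open>Invariance of spectral subspaces\<close>

sublocale contraction_sg "H1 \<times> UNIV" L S
proof
  show "contraction_semigroup (H1 \<times> UNIV) (\<lambda>z. norm (L z)) S"
    using semigroup by (simp add: phase_space_eq phase_norm_eq)
qed (auto simp: L_def R_add R_scaleC R_scaleR scaleC_prod_def)

lemma gen_eq: "gen = wave_operator A E f"
  using generator by (simp add: phase_space_eq phase_norm_eq)

lemma L_eq_0: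
  assumes "u \<in> H1" "L (u, v) = 0"
  shows "u = 0 \<and> v = 0"
proof -
  obtain C where "norm u \<le> C * norm (R u)" using norm_R_ge assms(1) by blast
  then show ?thesis using assms(2) by (simp add: L_def zero_prod_def)
qed

lemma Q_S_decreasing:
  assumes B: "B \<in> sets M" and zw: "(z, w) \<in> gen" and T: "0 \<le> T"
  shows "norm (L (Q B (S T z))) \<le> norm (L (Q B z))"
proof (rule commuting_norm_decreasing[OF _ _ _ _ _ zw T])
  fix z w :: "'a \<times> 'a" and r :: real
  assume z: "z \<in> H1 \<times> UNIV"
  show "Q B z \<in> H1 \<times> UNIV" using z R_E[OF _ B] by (auto simp: Q_def)
  show "Q B (r *\<^sub>R z) = r *\<^sub>R Q B z" by (simp add: Q_def E_scaleR[OF B])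
  show "Q B (z - w) = Q B z - Q B w" by (simp add: Q_def E_diff[OF B])
  show "norm (L (Q B z)) \<le> norm (L z)"
    using z R_E[OF _ B] by (auto simp: Q_def L_def norm_prod_def intro!: add_mono power_mono norm_E_le[OF B])
next
  fix z w assume "(z, w) \<in> gen"
  then show "(Q B z, Q B w) \<in> gen" unfolding gen_eq by (rule Q_wave_operator[OF B])
qed

text \<open>The part of the orbit over the complement of \<open>B\<close> starts at 0 and its phase
  norm cannot grow, so this norm stays 0; injectivity of \<open>L\<close> then makes the part itself
  vanish.\<close>

lemma Q_S_fixed:
  assumes B: "B \<in> sets M" and zw: "(z, w) \<in> gen" and T: "0 \<le> T" and z: "Q B z = z"
  shows "Q B (S T z) = S T z"
proof -
  let ?C = "space M - B"
  have C: "?C \<in> sets M" using B by (rule sets.compl_sets)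
  have E: "E ?C x = x - E B x" for x by (rule E_Compl[OF B])
  have zX: "z \<in> H1 \<times> UNIV" using zw by (simp add: generator_def)
  have "Q ?C z = 0"
    using z by (simp add: Q_def E prod_eq_iff)
  moreover have "L 0 = 0"
    using R_scaleR[of "fst z" 0] zX by (auto simp: L_def zero_prod_def)
  ultimately have "norm (L (Q ?C (S T z))) \<le> 0"
    using Q_S_decreasing[OF C zw T] by simp
  then have "L (E ?C (fst (S T z)), E ?C (snd (S T z))) = 0"
    by (simp add: Q_def)
  moreover have "E ?C (fst (S T z)) \<in> H1"
    using R_E[OF _ C] S_X[OF T zX] by (simp add: mem_Times_iff)
  ultimately have "E ?C (fst (S T z)) = 0 \<and> E ?C (snd (S T z)) = 0"
    by (intro L_eq_0)
  then show ?thesis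
    by (simp add: Q_def E prod_eq_iff)
qed

section \<open>Differentiable orbits over bounded spectral sets\<close>

lemma norm_R_fst_le: "norm (R (fst z)) \<le> norm (L z)"
  and norm_snd_L_le: "norm (snd z) \<le> norm (L z)"
  unfolding L_def by (rule norm_fst_le, rule norm_snd_le)

lemma norm_fst_L_le:
  obtains C where "\<And>z. z \<in> H1 \<times> UNIV \<Longrightarrow> norm (fst z) \<le> C * norm (L z)"
proof -
  obtain C where C: "0 < C" "\<And>u. u \<in> H1 \<Longrightarrow> norm u \<le> C * norm (R u)" using norm_R_ge by blast
  have "norm (fst z) \<le> C * norm (L z)" if "z \<in> H1 \<times> UNIV" for z
  proof -
    have "norm (fst z) \<le> C * norm (R (fst z))" using that by (intro C(2)) auto
    also have "\<dots> \<le> C * norm (L z)"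
      by (rule mult_left_mono[OF norm_R_fst_le less_imp_le[OF C(1)]])
    finally show ?thesis .
  qed
  then show thesis by (rule that)
qed

text \<open>Bounds on s and f(s) over \<open>B\<close> put both components of \<open>z\<close> into
  the domain of \<open>A\<close> and the velocity into that of f(A), so \<open>z\<close> lies in the
  domain of the generator. The form identities for the energy computations are collected along the
  way.\<close>

lemma range_Q_gen:
  assumes B: "B \<in> sets M" and b: "\<And>s. s \<in> B \<Longrightarrow> \<bar>s\<bar> \<le> b" "\<And>s. s \<in> B \<Longrightarrow> f s \<le> k"
    and d: "\<And>s. s \<in> B \<Longrightarrow> d \<le> f s"
    and z: "Q B z = z"
  obtains a y where "(fst z, a) \<in> A" "(norm y)\<^sup>2 \<le> k\<^sup>2 * (norm (snd z))\<^sup>2"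
    "d * (norm (snd z))\<^sup>2 \<le> Re (cinner y (snd z))"
    "Re (cinner (R (fst z)) (R (snd z))) = Re (cinner a (snd z))"
    "(norm (R (fst z)))\<^sup>2 = Re (cinner a (fst z))"
    "(z, (snd z, - (a + y))) \<in> gen"
proof -
  have u: "E B (fst z) = fst z" and v: "E B (snd z) = snd z"
    using z by (simp_all add: Q_def prod_eq_iff)
  obtain a where a: "(fst z, a) \<in> A" using range_E_A[OF B b(1) u] by blast
  obtain a' where a': "(snd z, a') \<in> A" using range_E_A[OF B b(1) v] by blast
  obtain y where y: "(snd z, y) \<in> SI f" "(norm y)\<^sup>2 \<le> k\<^sup>2 * (norm (snd z))\<^sup>2"
    "d * (norm (snd z))\<^sup>2 \<le> Re (cinner y (snd z))"
    using range_E_f[OF B b(2) d v] by blast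
  have "snd z \<in> H1" using Domain_A_norm_R[OF a'] by blast
  from wave_operator_I[OF a y(1) this] have "(z, (snd z, - (a + y))) \<in> gen"
    by (simp add: gen_eq)
  with a y(2,3) Re_cinner_R[OF a a'] Domain_A_norm_R[OF a] show thesis
    using that by blast
qed

text \<open>Invariance keeps \<open>S t z\<close> in the range of \<open>Q B\<close>, so the orbit
  is in the domain of the generator at every time. The energy needs the derivatives of
  \<open>R u\<close> and \<open>v\<close>, the cross term Re <u, v> that of \<open>u\<close> in
  H.\<close>

lemma bounded_orbit:
  assumes B: "B \<in> sets M" and b: "\<And>s. s \<in> B \<Longrightarrow> \<bar>s\<bar> \<le> b" "\<And>s. s \<in> B \<Longrightarrow> f s \<le> k"
    and d: "\<And>s. s \<in> B \<Longrightarrow> d \<le> f s"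
    and z: "Q B z = z" and t: "0 \<le> t" and uv: "S t z = (u, v)"
  obtains a y where "(u, a) \<in> A" "(norm y)\<^sup>2 \<le> k\<^sup>2 * (norm v)\<^sup>2" "d * (norm v)\<^sup>2 \<le> Re (cinner y v)"
    "Re (cinner (R u) (R v)) = Re (cinner a v)" "(norm (R u))\<^sup>2 = Re (cinner a u)"
    "((\<lambda>t. R (fst (S t z))) has_vector_derivative R v) (at_right t)"
    "((\<lambda>t. fst (S t z)) has_vector_derivative v) (at_right t)"
    "((\<lambda>t. snd (S t z)) has_vector_derivative - (a + y)) (at_right t)"
proof -
  obtain w where zw: "(z, w) \<in> gen" using range_Q_gen[OF B b d z] by metis
  then have zX: "z \<in> H1 \<times> UNIV" by (simp add: generator_def)
  have Sz: "Q B (u, v) = (u, v)" using Q_S_fixed[OF B zw t z] by (simp add: uv)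
  obtain a y where ay: "(u, a) \<in> A" "(norm y)\<^sup>2 \<le> k\<^sup>2 * (norm v)\<^sup>2" "d * (norm v)\<^sup>2 \<le> Re (cinner y v)"
    "Re (cinner (R u) (R v)) = Re (cinner a v)" "(norm (R u))\<^sup>2 = Re (cinner a u)"
    and "((u, v), (v, - (a + y))) \<in> gen"
    by (rule range_Q_gen[OF B b d Sz]) auto
  then have g: "(S t z, (v, - (a + y))) \<in> gen" by (simp add: uv)
  have "((\<lambda>t. R (fst (S t z))) has_vector_derivative R (fst (v, - (a + y)))) (at_right t)"
  proof (rule orbit_derivative_comp[OF t zX g, where C=1])
    fix z w :: "'a \<times> 'a" and r :: real
    assume z: "z \<in> H1 \<times> UNIV"
    show "R (fst (r *\<^sub>R z)) = r *\<^sub>R R (fst z)" using z by (auto simp: R_scaleR)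
    assume w: "w \<in> H1 \<times> UNIV"
    show "R (fst (z - w)) = R (fst z) - R (fst w)"
      using arg_cong[OF L_diff[OF z w], of fst] by (simp add: L_def)
  qed (simp add: norm_R_fst_le)
  moreover have "((\<lambda>t. snd (S t z)) has_vector_derivative snd (v, - (a + y))) (at_right t)"
    by (rule orbit_derivative_comp[OF t zX g, where C=1]) (simp_all add: norm_snd_L_le)
  moreover obtain C where C: "\<And>z. z \<in> H1 \<times> UNIV \<Longrightarrow> norm (fst z) \<le> C * norm (L z)"
    using norm_fst_L_le by blast
  have "((\<lambda>t. fst (S t z)) has_vector_derivative fst (v, - (a + y))) (at_right t)"
    by (rule orbit_derivative_comp[OF t zX g, where C=C]) (simp_all add: C)
  ultimately show thesis
    using that[OF ay] by simp
qed

lemma continuous_on_orbit_components: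
  assumes zX: "z \<in> H1 \<times> UNIV"
  shows "continuous_on {0..} (\<lambda>t. R (fst (S t z)))" (is ?R)
    and "continuous_on {0..} (\<lambda>t. fst (S t z))" (is ?u)
    and "continuous_on {0..} (\<lambda>t. snd (S t z))" (is ?v)
proof -
  have L: "continuous_on {0..} (\<lambda>t. L (S t z))" by (rule continuous_on_orbit[OF zX])
  show ?R ?v
    using continuous_on_fst[OF L] continuous_on_snd[OF L] by (simp_all add: L_def)
  obtain C where C: "\<And>z. z \<in> H1 \<times> UNIV \<Longrightarrow> norm (fst z) \<le> C * norm (L z)"
    using norm_fst_L_le by blast
  show ?u
    by (rule continuous_on_orbit_comp[OF zX, where C=C]) (simp_all add: C)
qed

lemma norm_L_square: "(norm (L z))\<^sup>2 = (norm (R (fst z)))\<^sup>2 + (norm (snd z))\<^sup>2"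
  by (simp add: L_def norm_prod_def)

section \<open>Conservation and decay of energy\<close>

lemma constant_energy:
  assumes B: "B \<in> sets M" and b: "\<And>s. s \<in> B \<Longrightarrow> \<bar>s\<bar> \<le> b" and f0: "\<And>s. s \<in> B \<Longrightarrow> f s = 0"
    and z: "Q B z = z" and T: "0 \<le> T"
  shows "norm (L (S T z)) = norm (L z)"
proof -
  \<comment> \<open>Vanishing of \<open>f\<close> is fed in as the bound 0 from above and below; the
    upper one forces the damping term \<open>y\<close> to be 0.\<close>
  have b': "\<bar>s\<bar> \<le> b" "f s \<le> 0" "0 \<le> f s" if "s \<in> B" for s using b[OF that] f0[OF that] by auto
  have zX: "z \<in> H1 \<times> UNIV"
    using range_Q_gen[OF B b' z] by (force simp: generator_def)
  \<comment> \<open>Contractivity already gives one inequality; showing that the negative of the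
    energy does not increase gives the other.\<close>
  let ?g = "\<lambda>t. - (Re (cinner (R (fst (S t z))) (R (fst (S t z)))) + Re (cinner (snd (S t z)) (snd (S t z))))"
  have g: "?g t = - (norm (L (S t z)))\<^sup>2" for t
    by (simp add: Re_cinner_self norm_L_square)
  note cont = continuous_on_orbit_components[OF zX, THEN continuous_on_subset[of _ _ "{0..T}"]]
  have "?g T \<le> ?g 0"
  proof (rule le_if_right_derivative_nonpos[OF T])
    show "continuous_on {0..T} ?g"
      by (intro continuous_intros bounded_bilinear.continuous_on[OF bounded_bilinear_Re_cinner] cont) auto
    fix t :: real assume t: "0 \<le> t" "t < T"
    obtain u v where uv: "S t z = (u, v)" by force
    obtain a y where y: "(norm y)\<^sup>2 \<le> 0\<^sup>2 * (norm v)\<^sup>2"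
      and R: "Re (cinner (R u) (R v)) = Re (cinner a v)"
      and deriv: "((\<lambda>t. R (fst (S t z))) has_vector_derivative R v) (at_right t)"
        "((\<lambda>t. snd (S t z)) has_vector_derivative - (a + y)) (at_right t)"
      by (rule bounded_orbit[OF B b' z t(1) uv])
    have "y = 0" using y by simp
    have "(?g has_vector_derivative - ((Re (cinner (R u) (R v)) + Re (cinner (R v) (R u)))
        + (Re (cinner v (- (a + y))) + Re (cinner (- (a + y)) v)))) (at_right t)" (is "(_ has_vector_derivative ?D) _")
      using bounded_bilinear.has_vector_derivative[OF bounded_bilinear_Re_cinner deriv(1) deriv(1)]
        bounded_bilinear.has_vector_derivative[OF bounded_bilinear_Re_cinner deriv(2) deriv(2)]
      unfolding uv fst_conv snd_conv by (intro has_vector_derivative_minus has_vector_derivative_add)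
    \<comment> \<open>The exchange terms Re <R u, R v> and Re <a, v> between potential and kinetic
      energy cancel.\<close>
    moreover have "?D = 0"
      using R Re_cinner_commute[of "R v" "R u"] Re_cinner_commute[of v a]
      by (simp add: \<open>y = 0\<close> cinner_minus_left cinner_minus_right)
    ultimately show "\<exists>D\<le>0. (?g has_vector_derivative D) (at_right t)" by auto
  qed
  then have "(norm (L z))\<^sup>2 \<le> (norm (L (S T z)))\<^sup>2"
    unfolding g by (simp add: S_0[OF zX])
  then have "norm (L z) \<le> norm (L (S T z))" by (rule power2_le_imp_le) simp
  then show ?thesis using S_contraction[OF T zX] by simp
qed

text \<open>
  For small \<open>\<epsilon>\<close> the functional \<open>\<parallel>S(t)z\<parallel>\<^sup>2 / 2 + \<epsilon> Re \<langle>u, v\<rangle>\<close> is nonnegative and decreases at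
  a rate of at least \<open>\<epsilon> \<parallel>S(t)z\<parallel>\<^sup>2 / 2\<close>.
\<close>

lemma decay_damped:
  assumes B: "B \<in> sets M" and b: "\<And>s. s \<in> B \<Longrightarrow> \<bar>s\<bar> \<le> b" "\<And>s. s \<in> B \<Longrightarrow> f s \<le> b"
    and d: "\<And>s. s \<in> B \<Longrightarrow> d \<le> f s" and "0 < d"
    and z: "Q B z = z"
  shows "((\<lambda>t. norm (L (S t z))) \<longlongrightarrow> 0) at_top"
proof -
  have zX: "z \<in> H1 \<times> UNIV"
    using range_Q_gen[OF B b d z] by (force simp: generator_def)
  obtain C where C: "0 < C" "\<And>u. u \<in> H1 \<Longrightarrow> norm u \<le> C * norm (R u)" using norm_R_ge by blast
  \<comment> \<open>The first bound, with |u| <= C |R u|, keeps the cross term below half of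
    \<open>\<phi>\<close>. For the second, the derivative of Re <u, v> contributes |v|^2, completing
    the decay to half of the full squared norm adds another half, and Young's inequality for Re <u,
    y> adds (C b)^2 / 2; the damping \<open>d\<close> must absorb the sum.\<close>
  define \<epsilon> where "\<epsilon> = min (1 / C) (d / (3 / 2 + (C * b)\<^sup>2 / 2))"
  have pos: "0 < 3 / 2 + (C * b)\<^sup>2 / 2" by (simp add: add_pos_nonneg)
  have \<epsilon>: "0 < \<epsilon>" "\<epsilon> * C \<le> 1" "\<epsilon> * (3 / 2 + (C * b)\<^sup>2 / 2) \<le> d"
  proof -
    show "0 < \<epsilon>" using C(1) \<open>0 < d\<close> pos by (simp add: \<epsilon>_def)
    have "\<epsilon> \<le> 1 / C" "\<epsilon> \<le> d / (3 / 2 + (C * b)\<^sup>2 / 2)" by (simp_all add: \<epsilon>_def)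
    then show "\<epsilon> * C \<le> 1" "\<epsilon> * (3 / 2 + (C * b)\<^sup>2 / 2) \<le> d"
      using C(1) pos by (simp_all add: pos_le_divide_eq)
  qed
  define \<phi> where "\<phi> t = (norm (L (S t z)))\<^sup>2" for t
  have \<phi>: "\<phi> t = (norm (R (fst (S t z))))\<^sup>2 + (norm (snd (S t z)))\<^sup>2" for t
    by (simp add: \<phi>_def norm_L_square)
  have cross: "\<bar>\<epsilon> * Re (cinner (fst (S t z)) (snd (S t z)))\<bar> \<le> \<phi> t / 2" if t: "0 \<le> t" for t
  proof -
    let ?u = "fst (S t z)" and ?v = "snd (S t z)"
    have u: "?u \<in> H1" using S_X[OF t zX] by (simp add: mem_Times_iff)
    have "\<bar>\<epsilon> * Re (cinner ?u ?v)\<bar> \<le> \<epsilon> * (norm ?u * norm ?v)"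
      using \<epsilon>(1) order_trans[OF abs_Re_le_cmod norm_cinner_le[of ?u ?v]] by (simp add: abs_mult)
    also have "\<dots> \<le> \<epsilon> * ((C * norm (R ?u)) * norm ?v)"
      using \<epsilon>(1) C(2)[OF u] by (intro mult_left_mono mult_right_mono) simp_all
    also have "\<dots> = (\<epsilon> * C) * (norm (R ?u) * norm ?v)" by simp
    also have "\<dots> \<le> 1 * (norm (R ?u) * norm ?v)"
      using \<epsilon>(2) by (intro mult_right_mono) simp_all
    also have "\<dots> \<le> \<phi> t / 2"
      using sum_squares_bound[of "norm (R ?u)" "norm ?v"] by (simp add: \<phi>)
    finally show ?thesis .
  qed
  have main: "\<epsilon> / 2 * T * \<phi> T \<le> \<phi> 0" if T: "0 \<le> T" for T
  proof -
    \<comment> \<open>Since \<open>\<phi>\<close> does not increase, \<open>k\<close> is a lower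
      bound for the decay rate on all of [0, T]. Adding k t to the functional replaces integrating
      that rate.\<close>
    define k where "k = \<epsilon> / 2 * \<phi> T"
    let ?V = "\<lambda>t. (1 / 2) * (Re (cinner (R (fst (S t z))) (R (fst (S t z)))) + Re (cinner (snd (S t z)) (snd (S t z))))
      + \<epsilon> * Re (cinner (fst (S t z)) (snd (S t z))) + k * t"
    have V: "?V t = \<phi> t / 2 + \<epsilon> * Re (cinner (fst (S t z)) (snd (S t z))) + k * t" for t
      by (simp add: Re_cinner_self \<phi>)
    note cont = continuous_on_orbit_components[OF zX, THEN continuous_on_subset[of _ _ "{0..T}"]]
    have "?V T \<le> ?V 0"
    proof (rule le_if_right_derivative_nonpos[OF T])
      show "continuous_on {0..T} ?V"
        by (intro continuous_intros bounded_bilinear.continuous_on[OF bounded_bilinear_Re_cinner] cont) auto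
      fix t :: real assume t: "0 \<le> t" "t < T"
      obtain u v where uv: "S t z = (u, v)" by force
      obtain a y where a: "(u, a) \<in> A" and y: "(norm y)\<^sup>2 \<le> b\<^sup>2 * (norm v)\<^sup>2" "d * (norm v)\<^sup>2 \<le> Re (cinner y v)"
        and Ruv: "Re (cinner (R u) (R v)) = Re (cinner a v)"
        and Ru: "(norm (R u))\<^sup>2 = Re (cinner a u)"
        and deriv: "((\<lambda>t. R (fst (S t z))) has_vector_derivative R v) (at_right t)"
          "((\<lambda>t. fst (S t z)) has_vector_derivative v) (at_right t)"
          "((\<lambda>t. snd (S t z)) has_vector_derivative - (a + y)) (at_right t)"
        by (rule bounded_orbit[OF B b d z t(1) uv])
      let ?D = "(1 / 2) * ((Re (cinner (R u) (R v)) + Re (cinner (R v) (R u)))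
        + (Re (cinner v (- (a + y))) + Re (cinner (- (a + y)) v)))
        + \<epsilon> * (Re (cinner u (- (a + y))) + Re (cinner v v)) + k"
      have "((\<lambda>t. k * t) has_vector_derivative k) (at_right t)"
        by (auto intro!: derivative_eq_intros simp flip: has_real_derivative_iff_has_vector_derivative)
      then have "(?V has_vector_derivative ?D) (at_right t)"
        using bounded_bilinear.has_vector_derivative[OF bounded_bilinear_Re_cinner deriv(1) deriv(1)]
          bounded_bilinear.has_vector_derivative[OF bounded_bilinear_Re_cinner deriv(2) deriv(3)]
          bounded_bilinear.has_vector_derivative[OF bounded_bilinear_Re_cinner deriv(3) deriv(3)]
        unfolding uv fst_conv snd_conv
        by (intro has_vector_derivative_add has_vector_derivative_mult_right)
      moreover have "?D \<le> 0"
      proof -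
        have D: "?D = - Re (cinner y v) + \<epsilon> * ((norm v)\<^sup>2 - (norm (R u))\<^sup>2 - Re (cinner u y)) + k"
          using Ruv Ru Re_cinner_commute[of "R v" "R u"] Re_cinner_commute[of v a] Re_cinner_commute[of v y]
            Re_cinner_commute[of u a]
          by (simp add: cinner_minus_left cinner_minus_right cinner_add_left cinner_add_right
              cinner_diff_left cinner_diff_right Re_cinner_self algebra_simps)
        \<comment> \<open>Poincare's and Young's inequalities cost half of |R u|^2, which the term
          -|R u|^2 pays for.\<close>
        have "- Re (cinner u y) \<le> norm u * norm y"
          using order_trans[OF abs_Re_le_cmod norm_cinner_le[of u y]] by linarith
        also have "\<dots> \<le> (C * norm (R u)) * norm y"
          using Domain_A_norm_R[OF a] C(2) by (intro mult_right_mono) simp_all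
        also have "\<dots> = norm (R u) * (C * norm y)" by simp
        also have "\<dots> \<le> ((norm (R u))\<^sup>2 + (C * norm y)\<^sup>2) / 2"
          using sum_squares_bound[of "norm (R u)" "C * norm y"] by simp
        also have "(C * norm y)\<^sup>2 \<le> (C * b)\<^sup>2 * (norm v)\<^sup>2"
          using mult_left_mono[OF y(1), of "C\<^sup>2"] by (simp add: power_mult_distrib mult.assoc)
        finally have "(norm v)\<^sup>2 - (norm (R u))\<^sup>2 - Re (cinner u y)
            \<le> (norm v)\<^sup>2 * (3 / 2 + (C * b)\<^sup>2 / 2) - ((norm (R u))\<^sup>2 + (norm v)\<^sup>2) / 2"
          by (simp add: field_simps)
        from mult_left_mono[OF this less_imp_le[OF \<epsilon>(1)]]
        have "\<epsilon> * ((norm v)\<^sup>2 - (norm (R u))\<^sup>2 - Re (cinner u y))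
            \<le> \<epsilon> * ((norm v)\<^sup>2 * (3 / 2 + (C * b)\<^sup>2 / 2) - ((norm (R u))\<^sup>2 + (norm v)\<^sup>2) / 2)" .
        also have "\<dots> = (\<epsilon> * (3 / 2 + (C * b)\<^sup>2 / 2)) * (norm v)\<^sup>2 - \<epsilon> / 2 * \<phi> t"
          unfolding \<phi> uv by (simp add: right_diff_distrib mult_ac)
        also have "(\<epsilon> * (3 / 2 + (C * b)\<^sup>2 / 2)) * (norm v)\<^sup>2 \<le> d * (norm v)\<^sup>2"
          by (rule mult_right_mono[OF \<epsilon>(3)]) simp
        finally have "?D \<le> k - \<epsilon> / 2 * \<phi> t" using y(2) D by linarith
        also have "\<phi> T \<le> \<phi> t"
          unfolding \<phi>_def using S_decreasing[OF t(1) less_imp_le[OF t(2)] zX] by (intro power_mono) simp_all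
        then have "k - \<epsilon> / 2 * \<phi> t \<le> 0" using \<epsilon>(1) by (simp add: k_def)
        finally show ?thesis .
      qed
      ultimately show "\<exists>D\<le>0. (?V has_vector_derivative D) (at_right t)" by blast
    qed
    \<comment> \<open>By the bound on the cross term, \<open>?V T\<close> is at least k T and
      \<open>?V 0\<close> is at most \<open>\<phi> 0\<close>.\<close>
    then show ?thesis
      unfolding V using cross[of 0] cross[OF T] by (simp add: k_def mult_ac abs_le_iff)
  qed
  have "(\<phi> \<longlongrightarrow> 0) at_top"
  proof (rule tendsto_sandwich[OF _ _ tendsto_const])
    show "eventually (\<lambda>T. \<phi> T \<le> \<phi> 0 * 2 / \<epsilon> * inverse T) at_top"
      using eventually_gt_at_top[of 0]
    proof eventually_elim
      fix T :: real assume "0 < T"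
      then show "\<phi> T \<le> \<phi> 0 * 2 / \<epsilon> * inverse T"
        using main[of T] \<epsilon>(1) by (simp add: field_simps)
    qed
    show "((\<lambda>T. \<phi> 0 * 2 / \<epsilon> * inverse T) \<longlongrightarrow> 0) at_top"
      by (rule tendsto_mult_right_zero[OF tendsto_inverse_0_at_top[OF filterlim_ident]])
  qed (simp add: \<phi>_def)
  from tendsto_real_sqrt[OF this] show ?thesis by (simp add: \<phi>_def)
qed

section \<open>The zero set of the damping\<close>

definition damping_zeros :: "real set" where
  "damping_zeros = {s \<in> real_spectrum A. f s = 0}"

lemma sets_damping_zeros: "damping_zeros \<in> sets M"
proof -
  have "{s \<in> space M. f s = 0} \<in> sets M" using measurable_f by measurable
  then show ?thesis by (simp add: damping_zeros_def space_M)
qed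

text \<open>Energy conservation was shown over bounded sets, so the zero set is cut to |s| <= n; by
  continuity of the scalar measure from below, some cut still projects \<open>x\<close> to a nonzero
  vector.\<close>

lemma exists_constant_energy:
  assumes x: "E damping_zeros x \<noteq> 0"
  shows "\<exists>z\<in>H1 \<times> UNIV. 0 < norm (L z) \<and> (\<forall>t\<ge>0. norm (L (S t z)) = norm (L z))"
proof -
  interpret finite_measure "\<mu> x" by (rule finite_measure_\<mu>)
  define B where "B n = {s \<in> damping_zeros. \<bar>s\<bar> \<le> real n}" for n
  have B: "B n \<in> sets M" for n
  proof -
    have "{s \<in> space M. \<bar>(\<lambda>s. s) s\<bar> \<le> real n} \<in> sets M" using measurable_id by measurable
    from sets.Int[OF sets_damping_zeros this] show ?thesis
      by (rule back_subst[of "\<lambda>X. X \<in> sets M"]) (auto simp: B_def damping_zeros_def space_M)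
  qed
  have "(\<Union>n. B n) = damping_zeros" using real_arch_simple by (auto simp: B_def)
  moreover have "(\<lambda>n. measure (\<mu> x) (B n)) \<longlonglongrightarrow> measure (\<mu> x) (\<Union>n. B n)"
    by (rule finite_Lim_measure_incseq) (use B in \<open>auto simp: sets_\<mu> incseq_def B_def\<close>)
  ultimately have "(\<lambda>n. (norm (E (B n) x))\<^sup>2) \<longlonglongrightarrow> (norm (E damping_zeros x))\<^sup>2"
    by (simp add: measure_\<mu> B sets_damping_zeros)
  then have "eventually (\<lambda>n. 0 < (norm (E (B n) x))\<^sup>2) sequentially"
    by (rule order_tendstoD(1)) (use x in simp)
  then obtain n where n: "E (B n) x \<noteq> 0"
    by (auto simp: eventually_sequentially)
  \<comment> \<open>Zero displacement lies in \<open>H1\<close>, and the norm of \<open>L ?z\<close>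
    is that of the velocity.\<close>
  let ?z = "(0, E (B n) x)"
  have z: "Q (B n) ?z = ?z" by (simp add: Q_def E_zero[OF B] E_idem[OF B])
  have "(0::'a) \<in> H1" and R0: "R 0 = 0"
    using SI_zero[OF measurable_rt] H1_I R_eq by blast+
  then have "?z \<in> H1 \<times> UNIV" by simp
  moreover have "0 < norm (L ?z)" using n by (simp add: L_def R0 zero_prod_def)
  moreover have "norm (L (S t ?z)) = norm (L ?z)" if "0 \<le> t" for t
    by (rule constant_energy[OF B _ _ z that, of "real n"]) (auto simp: B_def damping_zeros_def)
  ultimately show ?thesis by blast
qed

lemma stable:
  assumes null: "\<And>x. E damping_zeros x = 0" and z: "z \<in> H1 \<times> UNIV"
  shows "((\<lambda>t. norm (L (S t z))) \<longlongrightarrow> 0) at_top"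
proof -
  \<comment> \<open>The upper bounds put the range into the domain of the generator, the lower one
    gives uniform damping. \<open>Suc n\<close> keeps the lower bound meaningful at n = 0, and the
    sets increase with \<open>n\<close>.\<close>
  define B where "B n = {s \<in> space M. \<bar>s\<bar> \<le> real n \<and> f s \<le> real n \<and> inverse (real (Suc n)) \<le> f s}" for n
  have B: "B n \<in> sets M" for n
  proof -
    have "{s \<in> space M. \<bar>(\<lambda>s. s) s\<bar> \<le> real n \<and> f s \<le> real n \<and> inverse (real (Suc n)) \<le> f s} \<in> sets M"
      using measurable_id measurable_f by measurable
    then show ?thesis by (simp add: B_def)
  qed
  have E_lim: "(\<lambda>n. x - E (B n) x) \<longlonglongrightarrow> 0" for x
  proof -
    interpret finite_measure "\<mu> x" by (rule finite_measure_\<mu>)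
    let ?C = "\<lambda>n. space M - B n"
    have C: "?C n \<in> sets M" for n using B by blast
    \<comment> \<open>A point with f(s) > 0 enters \<open>B n\<close> once n is large compared with
      |s|, f(s) and 1 / f(s), so only zeros of \<open>f\<close> stay in every complement. Continuity
      of the finite scalar measure from above then applies.\<close>
    have "(\<Inter>n. ?C n) = damping_zeros"
    proof (intro equalityI subsetI)
      fix s assume s: "s \<in> (\<Inter>n. ?C n)"
      show "s \<in> damping_zeros"
      proof (rule ccontr)
        assume "s \<notin> damping_zeros"
        with s have "s \<in> real_spectrum A" "f s \<noteq> 0" by (auto simp: damping_zeros_def space_M)
        then have "0 < f s" using f_nonneg by force
        then obtain k where k: "inverse (real (Suc k)) < f s" using reals_Archimedean by blast
        obtain m where m: "max \<bar>s\<bar> (f s) \<le> real m" using real_arch_simple by blast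
        have "inverse (real (Suc (max k m))) \<le> inverse (real (Suc k))"
          by (intro le_imp_inverse_le) simp_all
        also note k
        finally have "s \<in> B (max k m)"
          using m \<open>s \<in> real_spectrum A\<close> by (auto simp: B_def space_M)
        then show False using s by blast
      qed
    qed (auto simp: damping_zeros_def B_def space_M)
    moreover have "(\<lambda>n. measure (\<mu> x) (?C n)) \<longlonglongrightarrow> measure (\<mu> x) (\<Inter>n. ?C n)"
    proof (rule finite_Lim_measure_decseq)
      show "range ?C \<subseteq> sets (\<mu> x)" using C by (auto simp: sets_\<mu>)
      show "decseq ?C"
      proof (rule decseq_SucI)
        fix n
        have "inverse (real (Suc (Suc n))) \<le> inverse (real (Suc n))"
          by (intro le_imp_inverse_le) simp_all
        note le = order_trans[OF this]
        show "?C (Suc n) \<subseteq> ?C n"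
        proof (rule Diff_mono[OF order_refl], rule subsetI)
          fix s assume "s \<in> B n"
          then show "s \<in> B (Suc n)" using le[of "f s"] by (simp add: B_def)
        qed
      qed
    qed
    ultimately have "(\<lambda>n. (norm (E (?C n) x))\<^sup>2) \<longlonglongrightarrow> 0"
      by (simp add: measure_\<mu> C sets_damping_zeros null)
    then have "(\<lambda>n. E (?C n) x) \<longlonglongrightarrow> 0" by (simp add: tendsto_norm_zero_iff)
    then show ?thesis by (simp add: E_Compl[OF B])
  qed
  have L_lim: "(\<lambda>n. norm (L (z - Q (B n) z))) \<longlonglongrightarrow> 0"
  proof -
    \<comment> \<open>\<open>R\<close> commutes with the projections, so convergence in the phase
      norm reduces to strong convergence at \<open>R (fst z)\<close> and
      \<open>snd z\<close>.\<close>
    have "L (z - Q (B n) z) = (R (fst z) - E (B n) (R (fst z)), snd z - E (B n) (snd z))" for n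
    proof -
      have "Q (B n) z \<in> H1 \<times> UNIV" using z R_E[OF _ B] by (auto simp: Q_def)
      from L_diff[OF z this] show ?thesis
        using z R_E[OF _ B] by (auto simp: L_def Q_def)
    qed
    then show ?thesis
      using tendsto_norm_zero[OF tendsto_Pair[OF E_lim[of "R (fst z)"] E_lim[of "snd z"], folded zero_prod_def]] by simp
  qed
  show ?thesis
  proof (rule tendstoI)
    fix e :: real assume "0 < e"
    then have "eventually (\<lambda>n. norm (L (z - Q (B n) z)) < e / 2) sequentially"
      by (intro order_tendstoD(2)[OF L_lim]) simp
    then obtain n where n: "norm (L (z - Q (B n) z)) < e / 2"
      by (auto simp: eventually_sequentially)
    let ?w = "Q (B n) z"
    have w: "?w \<in> H1 \<times> UNIV" using z R_E[OF _ B] by (auto simp: Q_def)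
    have "Q (B n) ?w = ?w" by (simp add: Q_def E_idem[OF B])
    then have "((\<lambda>t. norm (L (S t ?w))) \<longlongrightarrow> 0) at_top"
      by (rule decay_damped[OF B, rotated -1, where b="real n" and d="inverse (real (Suc n))"]) (auto simp: B_def)
    then have "eventually (\<lambda>t. norm (L (S t ?w)) < e / 2) at_top"
      by (rule order_tendstoD(2)) (use \<open>0 < e\<close> in simp)
    with eventually_ge_at_top[of 0] show "eventually (\<lambda>t. dist (norm (L (S t z))) 0 < e) at_top"
    proof eventually_elim
      fix t :: real assume t: "0 \<le> t" and wt: "norm (L (S t ?w)) < e / 2"
      \<comment> \<open>Half of \<open>e\<close> is for the decaying projected datum, half for the
        remainder, which contractivity bounds uniformly in time.\<close>
      have "L (S t z) = L (S t (z - ?w)) + L (S t ?w)"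
        using t z w by (simp add: S_diff L_diff S_X)
      then have "norm (L (S t z)) \<le> norm (L (S t (z - ?w))) + norm (L (S t ?w))"
        by (simp add: norm_triangle_ineq)
      also have "norm (L (S t (z - ?w))) \<le> norm (L (z - ?w))"
        by (rule S_contraction[OF t X_diff[OF z w]])
      finally show "dist (norm (L (S t z))) 0 < e" using n wt by simp
    qed
  qed
qed

end

theorem theorem9p1:
  fixes A :: "('a::complex_hilbert \<times> 'a) set"
    and E :: "real set \<Rightarrow> 'a \<Rightarrow> 'a"
    and f :: "real \<Rightarrow> real"
    and S :: "real \<Rightarrow> 'a \<times> 'a \<Rightarrow> 'a \<times> 'a"
    and Z :: "real set"
  assumes separable: "separable_space (euclidean :: 'a topology)"
    and selfadj: "selfadjoint A"
    and pos: "strictly_positive A"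
    and spec: "is_spectral_measure A E"
    and f_cont: "continuous_on (real_spectrum A) f"
    and f_nonneg: "\<forall>s\<in>real_spectrum A. 0 \<le> f s"
    and semigroup: "contraction_semigroup (phase_space A E) (phase_norm A E) S"
    and gen: "generator (phase_space A E) (phase_norm A E) S = wave_operator A E f"
    and Z_def: "Z = {s \<in> real_spectrum A. f s = 0}"
  shows "((\<exists>x. E Z x \<noteq> 0) \<longrightarrow>
            (\<exists>z\<in>phase_space A E. \<exists>c>0. \<forall>t\<ge>0. energy A E S z t = c) \<and>
            \<not> stable_semigroup (phase_space A E) (phase_norm A E) S) \<and>
         ((\<forall>x. E Z x = 0) \<and> countable Z \<longrightarrow>
            stable_semigroup (phase_space A E) (phase_norm A E) S) \<and>
         (Z = {} \<longrightarrow> stable_semigroup (phase_space A E) (phase_norm A E) S)"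
proof -
  interpret damped_wave A E f S
    by unfold_locales fact+
  have Z: "Z = damping_zeros"
    by (simp add: Z_def damping_zeros_def)
  have stable': "stable_semigroup (phase_space A E) (phase_norm A E) S" if "\<forall>x. E Z x = 0"
    unfolding stable_semigroup_def phase_space_eq phase_norm_eq
    by (intro ballI stable) (use that in \<open>simp_all add: Z\<close>)
  have "(\<exists>z\<in>phase_space A E. \<exists>c>0. \<forall>t\<ge>0. energy A E S z t = c) \<and>
      \<not> stable_semigroup (phase_space A E) (phase_norm A E) S" if ex: "\<exists>x. E Z x \<noteq> 0"
  proof -
    obtain z where z: "z \<in> H1 \<times> UNIV" "0 < norm (L z)" "\<And>t. 0 \<le> t \<Longrightarrow> norm (L (S t z)) = norm (L z)"
      using exists_constant_energy ex unfolding Z by blast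
    have "\<forall>t\<ge>0. energy A E S z t = 1 / 2 * (norm (L z))\<^sup>2"
      using z(3) by (simp add: energy_def phase_norm_eq)
    moreover have "0 < 1 / 2 * (norm (L z))\<^sup>2" using z(2) by simp
    moreover have "\<not> stable_semigroup (phase_space A E) (phase_norm A E) S"
    proof
      assume "stable_semigroup (phase_space A E) (phase_norm A E) S"
      then have "((\<lambda>t. norm (L (S t z))) \<longlongrightarrow> 0) at_top"
        using z(1) unfolding stable_semigroup_def phase_space_eq phase_norm_eq by blast
      then have "((\<lambda>t::real. norm (L z)) \<longlongrightarrow> 0) at_top"
        by (rule Lim_transform_eventually) (use z(3) in \<open>auto intro: eventually_mono[OF eventually_ge_at_top[of 0]]\<close>)
      then show False using z(2) by (simp add: tendsto_const_iff)
    qed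
    ultimately show ?thesis using z(1) unfolding phase_space_eq by blast
  qed
  moreover have "\<forall>x. E Z x = 0" if "Z = {}" using that E_empty by simp
  ultimately show ?thesis using stable' by blast
qed

end
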